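(* Let $\{p_k\}_{k\ge0}$ be the antisymmetric orthogonal polynomials on the Sierpinski gasket $SG$ obtained from $\{P_{k3}\}_{k\ge 0}$ by the monic Gram–Schmidt process, let $d_k=\|p_k\|_{L^2}^{-1}$, $f_{k+1}(x)=-\int_{SG}G(x,y)p_k(y)\,d\mu(y)$, $b_k=d_k^2\langle f_{k+1},p_k\rangle$ for $k\ge0$, and $c_k=d_{k-1}^2/d_k^2$ for $k\ge1$. Let $\|G\|_{L^2}=\big(\iint_{SG\times SG}G(x,y)^2\,d\mu(x)\,d\mu(y)\big)^{1/2}$. Then: (a) $-\|G\|_{L^2}\le b_k<0$ for each $k\ge0$; (b) $0<c_k\le\|G\|_{L^2}^2$ for each $k\ge1$; (c) $d_{k+1}^{-1}\le\|G\|_{L^2}\,d_k^{-1}$ for each $k\ge0$. In particular, $d_k^{-1}\le d_0^{-1}\|G\|_{L^2}^k$ for each $k\ge0$.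
   Context: Sierpinski gasket: let $q_0,q_1,q_2$ be the vertices of an equilateral triangle in $\mathbb{R}^2$, $F_i(x)=\tfrac12(x-q_i)+q_i$, and $SG$ the nonempty compact set with $SG=\bigcup_{i=0}^2F_i(SG)$. For a word $w=(w_1,\dots,w_m)$, $F_w=F_{w_1}\circ\cdots\circ F_{w_m}$ and $F_w(SG)$ is a cell of level $m$. $V_0=\{q_0,q_1,q_2\}$ is the boundary, $V_m=\bigcup_iF_iV_{m-1}$, $V_*=\bigcup_mV_m$; for distinct $x,y\in V_m$, $x\sim_m y$ iff $x,y$ lie in a common cell of level $m$. $\mu$ is the probability measure on $SG$ giving mass $3^{-m}$ to each cell of level $m$; all functions are real-valued, $\langle f,g\rangle=\int_{SG}fg\,d\mu$ and $\|f\|_{L^2}^2=\langle f,f\rangle$. Laplacian: $\Delta u(x)=\lim_{m\to\infty}\tfrac32 5^m\sum_{y\sim_m x}(u(y)-u(x))$ for $x\in V_*\setminus V_0$; a continuous $u$ is in the domain with $\Delta u=f$ ($f$ continuous on $SG$) if these limits converge uniformly to $f$ on $V_*\setminus V_0$. Derivatives at $q_0$: $\partial_nu(q_0)=\lim_m(5/3)^m\big(2u(q_0)-u(F_0^mq_1)-u(F_0^mq_2)\big)$ and $\partial_Tu(q_0)=\lim_m5^m\big(u(F_0^mq_1)-u(F_0^mq_2)\big)$. Green's function: $G(x,y)$ is the continuous symmetric kernel on $SG\times SG$ such that for every continuous $f$ the unique solution of $-\Delta u=f$, $u|_{V_0}=0$ is $u(x)=\int_{SG}G(x,y)f(y)\,d\mu(y)$.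 The antisymmetric monomial $P_{j3}$ ($j\ge0$) is the unique function with $\Delta^{j+1}P_{j3}=0$ and, for $0\le m\le j$, $\Delta^mP_{j3}(q_0)=0$, $\partial_n\Delta^mP_{j3}(q_0)=0$, $\partial_T\Delta^mP_{j3}(q_0)=\delta_{m,j}$. Gram–Schmidt: $p_0=P_{03}$ and $p_j=P_{j3}-\sum_{l=0}^{j-1}d_l^2\langle P_{j3},p_l\rangle p_l$ for $j\ge1$, where $d_l>0$ and $d_l^{-2}=\|p_l\|_{L^2}^2$. *)

theory Defs
  imports "HOL-Analysis.Analysis"
begin

definition equilateral :: "(3 \<Rightarrow> real^2) \<Rightarrow> bool" where
  "equilateral q \<longleftrightarrow> (\<exists>s>0. \<forall>i j. i \<noteq> j \<longrightarrow> dist (q i) (q j) = s)"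

definition sgmap :: "(3 \<Rightarrow> real^2) \<Rightarrow> 3 \<Rightarrow> real^2 \<Rightarrow> real^2" where
  "sgmap q i x = (1/2) *\<^sub>R (x - q i) + q i"

definition sgmap_word :: "(3 \<Rightarrow> real^2) \<Rightarrow> 3 list \<Rightarrow> real^2 \<Rightarrow> real^2" where
  "sgmap_word q w = foldr (sgmap q) w"

definition is_gasket :: "(3 \<Rightarrow> real^2) \<Rightarrow> (real^2) set \<Rightarrow> bool" where
  "is_gasket q SG \<longleftrightarrow> SG \<noteq> {} \<and> compact SG \<and> SG = (\<Union>i. sgmap q i ` SG)"

primrec vertices :: "(3 \<Rightarrow> real^2) \<Rightarrow> nat \<Rightarrow> (real^2) set" where
  "vertices q 0 = range q"
| "vertices q (Suc m) = (\<Union>i. sgmap q i ` vertices q m)"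

definition adjacent :: "(3 \<Rightarrow> real^2) \<Rightarrow> (real^2) set \<Rightarrow> nat \<Rightarrow> real^2 \<Rightarrow> real^2 \<Rightarrow> bool" where
  "adjacent q SG m x y \<longleftrightarrow> x \<in> vertices q m \<and> y \<in> vertices q m \<and> x \<noteq> y \<and>
     (\<exists>w. length w = m \<and> x \<in> sgmap_word q w ` SG \<and> y \<in> sgmap_word q w ` SG)"

definition is_gasket_measure ::
    "(3 \<Rightarrow> real^2) \<Rightarrow> (real^2) set \<Rightarrow> (real^2) measure \<Rightarrow> bool" where
  "is_gasket_measure q SG \<mu> \<longleftrightarrow>
     sets \<mu> = sets (restrict_space borel SG) \<and> emeasure \<mu> SG = 1 \<and>
     (\<forall>w. emeasure \<mu> (sgmap_word q w ` SG) = ennreal ((1/3) ^ length w))"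

(* Functions on SG are represented by functions on the plane; only their values on SG matter. *)

definition l2_inner :: "(real^2) measure \<Rightarrow> (real^2 \<Rightarrow> real) \<Rightarrow> (real^2 \<Rightarrow> real) \<Rightarrow> real" where
  "l2_inner \<mu> f g = (LINT x|\<mu>. f x * g x)"

definition l2_norm :: "(real^2) measure \<Rightarrow> (real^2 \<Rightarrow> real) \<Rightarrow> real" where
  "l2_norm \<mu> f = sqrt (l2_inner \<mu> f f)"

definition l2_norm_kernel :: "(real^2) measure \<Rightarrow> (real^2 \<Rightarrow> real^2 \<Rightarrow> real) \<Rightarrow> real" where
  "l2_norm_kernel \<mu> G = sqrt (LINT y|\<mu>. (LINT x|\<mu>. (G x y)\<^sup>2))"

definition graph_laplacian ::
    "(3 \<Rightarrow> real^2) \<Rightarrow> (real^2) set \<Rightarrow> nat \<Rightarrow> (real^2 \<Rightarrow> real) \<Rightarrow> real^2 \<Rightarrow> real" where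
  "graph_laplacian q SG m u x = (3/2) * 5 ^ m * (\<Sum>y | adjacent q SG m x y. u y - u x)"

(* u lies in the domain of the Laplacian, with Laplacian f. The level-m expression makes
   sense only at points of V_m, and a point of V_* lies in V_m for all large m; uniform
   convergence on V_* - V_0 therefore bounds the error on V_m - V_0 at stage m. (Demanding the
   bound on all of V_* - V_0 at each stage, with empty sums off V_m, would force f = 0.)
   Pointwise convergence to f on V_* - V_0 follows. *)
definition has_laplacian ::
    "(3 \<Rightarrow> real^2) \<Rightarrow> (real^2) set \<Rightarrow> (real^2 \<Rightarrow> real) \<Rightarrow> (real^2 \<Rightarrow> real) \<Rightarrow> bool" where
  "has_laplacian q SG u f \<longleftrightarrow> continuous_on SG u \<and> continuous_on SG f \<and>
     (\<forall>\<epsilon>>0. \<exists>M. \<forall>m\<ge>M. \<forall>x \<in> vertices q m - vertices q 0.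
        \<bar>graph_laplacian q SG m u x - f x\<bar> < \<epsilon>)"

primrec has_laplacian_pow ::
    "(3 \<Rightarrow> real^2) \<Rightarrow> (real^2) set \<Rightarrow> nat \<Rightarrow> (real^2 \<Rightarrow> real) \<Rightarrow> (real^2 \<Rightarrow> real) \<Rightarrow> bool" where
  "has_laplacian_pow q SG 0 u f \<longleftrightarrow> (\<forall>x\<in>SG. f x = u x)"
| "has_laplacian_pow q SG (Suc n) u f \<longleftrightarrow>
     (\<exists>g. has_laplacian_pow q SG n u g \<and> has_laplacian q SG g f)"

definition has_normal_deriv :: "(3 \<Rightarrow> real^2) \<Rightarrow> (real^2 \<Rightarrow> real) \<Rightarrow> real \<Rightarrow> bool" where
  "has_normal_deriv q u a \<longleftrightarrow>
     (\<lambda>m. (5/3) ^ m * (2 * u (q 0) - u ((sgmap q 0 ^^ m) (q 1)) - u ((sgmap q 0 ^^ m) (q 2))))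
       \<longlonglongrightarrow> a"

definition has_tangential_deriv :: "(3 \<Rightarrow> real^2) \<Rightarrow> (real^2 \<Rightarrow> real) \<Rightarrow> real \<Rightarrow> bool" where
  "has_tangential_deriv q u a \<longleftrightarrow>
     (\<lambda>m. 5 ^ m * (u ((sgmap q 0 ^^ m) (q 1)) - u ((sgmap q 0 ^^ m) (q 2)))) \<longlonglongrightarrow> a"

(* The equivalence says that G f solves the Dirichlet problem -(Laplacian) u = f, u = 0 on V_0,
   and that every solution agrees with it on SG. *)
definition is_green_function ::
    "(3 \<Rightarrow> real^2) \<Rightarrow> (real^2) set \<Rightarrow> (real^2) measure \<Rightarrow> (real^2 \<Rightarrow> real^2 \<Rightarrow> real) \<Rightarrow> bool" where
  "is_green_function q SG \<mu> G \<longleftrightarrow>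
     continuous_on (SG \<times> SG) (\<lambda>(x, y). G x y) \<and>
     (\<forall>x\<in>SG. \<forall>y\<in>SG. G x y = G y x) \<and>
     (\<forall>f. continuous_on SG f \<longrightarrow>
        (\<forall>u. has_laplacian q SG u (\<lambda>x. - f x) \<and> (\<forall>v\<in>vertices q 0. u v = 0) \<longleftrightarrow>
             (\<forall>x\<in>SG. u x = (LINT y|\<mu>. G x y * f y))))"

definition is_antisym_monomial ::
    "(3 \<Rightarrow> real^2) \<Rightarrow> (real^2) set \<Rightarrow> nat \<Rightarrow> (real^2 \<Rightarrow> real) \<Rightarrow> bool" where
  "is_antisym_monomial q SG j P \<longleftrightarrow>
     has_laplacian_pow q SG (Suc j) P (\<lambda>x. 0) \<and>
     (\<forall>m\<le>j. \<exists>g. has_laplacian_pow q SG m P g \<and>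
        g (q 0) = 0 \<and> has_normal_deriv q g 0 \<and>
        has_tangential_deriv q g (if m = j then 1 else 0))"

end

theory Submission
  imports Defs
begin

text \<open>
  The function \<open>u = f\<^sub>k\<^sub>+\<^sub>1\<close> solves \<open>\<Delta>u = p\<^sub>k\<close> with zero boundary values. Since \<open>\<Delta>\<close> maps each antisymmetric
  monomial to its predecessor, \<open>u\<close> differs from \<open>P\<^sub>k\<^sub>+\<^sub>1\<close> plus lower monomials by a harmonic function
  that is antisymmetric on the boundary, that is, by a multiple of \<open>P\<^sub>0\<close>. Hence \<open>p\<^sub>k\<^sub>+\<^sub>1\<close> is the
  component of \<open>f\<^sub>k\<^sub>+\<^sub>1\<close> orthogonal to \<open>p\<^sub>0, \<dots>, p\<^sub>k\<close>, and Cauchy--Schwarz gives (c), which implies (b).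
  The upper bound in (a) is strict positivity of the Green operator: the renormalised graph
  energies of \<open>u\<close> increase to \<open>-\<integral>u \<Delta>u\<close>. Uniqueness of the monomials rests on two facts:
  a function with vanishing Laplacian is discretely harmonic at every level, and along the cells
  shrinking to \<open>q\<^sub>0\<close> its symmetric and antisymmetric parts decay exactly like \<open>(3/5)\<^sup>m\<close> and \<open>(1/5)\<^sup>m\<close>.
\<close>

section \<open>Words, cells and vertices\<close>

text \<open>The monomials are specified by their jets at \<open>q 0\<close> alone, so their
  antisymmetry is a theorem: \<open>P j\<close> plus its mirror image has a vanishing jet and hence
  vanishes. Antisymmetry leaves a harmonic function with value 0 at \<open>q 0\<close> just one free
  parameter. That is why a multiple of \<open>P 0\<close> is the only correction to the integrated
  polynomial, and its coefficient never has to be computed, because \<open>p (k + 1)\<close> is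
  orthogonal to \<open>P 0\<close>.

  The measure is prescribed on cells only, so integrals are reached as limits of vertex sums. The
  constants fit together as follows: a cell of mass \<open>(1/3) ^ m\<close> is shared by three
  corners and an interior vertex lies in two cells, which gives it the weight
  \<open>2/3 * (1/3) ^ m\<close>. Multiplied by the factor \<open>3/2 * 5 ^ m\<close> of the
  Laplacian this is \<open>(5/3) ^ m\<close>, and 3/5 is exactly the factor by which one harmonic
  subdivision lowers the energy.

  The lower bound in (a) comes from reading \<open>- b k\<close> as a Rayleigh quotient of the Green
  operator, whose operator norm is at most the norm of its kernel.\<close>

lemma three_eq_0: "(3::3) = 0"
  by simp

text \<open>The library enumerates type \<open>3\<close> as 1, 2, 3. Since 3 is 0 there, the sum can
  be indexed by 0, 1, 2 like the corners.\<close>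

lemma sum_UNIV_3: "(\<Sum>i\<in>UNIV. h (i::3)) = h 0 + h 1 + (h 2 :: real)"
  using sum_3[of h] unfolding three_eq_0 by simp

lemma forall_3_eq: "(\<forall>i::3. Q i) \<longleftrightarrow> Q 0 \<and> Q 1 \<and> Q 2"
  using forall_3[of Q] unfolding three_eq_0 by blast

lemma sgmap_fixpoint [simp]: "sgmap q i (q i) = q i"
  by (simp add: sgmap_def)

lemma sgmap_swap: "sgmap q i (q j) = sgmap q j (q i)"
  by (simp add: sgmap_def vec_eq_iff field_simps)

lemma dist_sgmap: "dist (sgmap q i x) (sgmap q i y) = dist x y / 2"
proof -
  have "sgmap q i x - sgmap q i y = (1/2) *\<^sub>R (x - y)"
    by (simp add: sgmap_def scaleR_diff_right)
  then show ?thesis by (simp add: dist_norm)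
qed

lemma sgmap_eq_iff [simp]: "sgmap q i x = sgmap q i y \<longleftrightarrow> x = y"
  by (simp add: sgmap_def)

lemma sgmap_word_Nil [simp]: "sgmap_word q [] x = x"
  by (simp add: sgmap_word_def)

lemma sgmap_word_Cons [simp]: "sgmap_word q (a # w) x = sgmap q a (sgmap_word q w x)"
  by (simp add: sgmap_word_def)

lemma sgmap_word_append: "sgmap_word q (v @ w) x = sgmap_word q v (sgmap_word q w x)"
  by (induction v) auto

lemma sgmap_word_eq_iff [simp]: "sgmap_word q w x = sgmap_word q w y \<longleftrightarrow> x = y"
  by (induction w) auto

lemma dist_sgmap_word: "dist (sgmap_word q w x) (sgmap_word q w y) = dist x y / 2 ^ length w"
  by (induction w) (auto simp: dist_sgmap)

lemma continuous_on_sgmap_word: "continuous_on S (sgmap_word q w)"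
proof (induction w)
  case (Cons a w)
  then show ?case
    unfolding sgmap_word_Cons sgmap_def by (intro continuous_intros)
qed (simp add: sgmap_word_def)

lemma sgmap_word_replicate: "sgmap_word q (replicate m i) x = (sgmap q i ^^ m) x"
  by (induction m) auto

abbreviation words :: "nat \<Rightarrow> 3 list set" where
  "words m \<equiv> {w. length w = m}"

lemma finite_words [simp]: "finite (words m)"
  using finite_lists_length_eq[of "UNIV :: 3 set" m] by simp

lemma card_words: "card (words m) = 3 ^ m"
  using card_lists_length_eq[of "UNIV :: 3 set" m] by simp

text \<open>Letters are appended at the end because this subdivides a cell: sums over level m + 1
  can then be grouped by the parent cell of level m.\<close>

lemma words_Suc: "words (Suc m) = (\<lambda>(w, i). w @ [i]) ` (words m \<times> UNIV)"
proof (intro set_eqI iffI)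
  fix w assume "w \<in> words (Suc m)"
  then have "w = butlast w @ [last w]" "butlast w \<in> words m" by (auto simp: length_Suc_conv)
  then show "w \<in> (\<lambda>(w, i). w @ [i]) ` (words m \<times> UNIV)" by (metis (no_types, lifting) SigmaI UNIV_I case_prod_conv imageI)
qed auto

lemma sum_words_Suc: "(\<Sum>w\<in>words (Suc m). h w) = (\<Sum>w\<in>words m. \<Sum>i\<in>UNIV. h (w @ [i]))"
proof -
  have "(\<Sum>w\<in>words (Suc m). h w) = (\<Sum>(w, i)\<in>words m \<times> UNIV. h (w @ [i]))"
    unfolding words_Suc by (subst sum.reindex) (auto simp: inj_on_def case_prod_beta)
  also have "\<dots> = (\<Sum>w\<in>words m. \<Sum>i\<in>UNIV. h (w @ [i]))"
    by (simp add: sum.cartesian_product)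
  finally show ?thesis .
qed

lemma vertices_eq: "vertices q m = (\<lambda>(w, i). sgmap_word q w (q i)) ` (words m \<times> UNIV)"
proof (induction m)
  case 0
  then show ?case by (force simp: image_iff)
next
  case (Suc m)
  have "words (Suc m) = (\<Union>a. (#) a ` words m)" by (auto simp: length_Suc_conv)
  then show ?case unfolding vertices.simps Suc by force
qed

locale gasket =
  fixes q :: "3 \<Rightarrow> real^2" and SG :: "(real^2) set"
  assumes equi: "equilateral q" and gasket: "is_gasket q SG"
begin

lemma compact_SG: "compact SG" and SG_ne: "SG \<noteq> {}" and SG_eq: "SG = (\<Union>i. sgmap q i ` SG)"
  using gasket by (auto simp: is_gasket_def)

lemma sgmap_in_SG: "x \<in> SG \<Longrightarrow> sgmap q i x \<in> SG"
  using SG_eq by blast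

lemma sgmap_cases:
  assumes "x \<in> SG" obtains i y where "y \<in> SG" "x = sgmap q i y"
  using assms SG_eq by blast

lemma sgmap_word_in_SG: "x \<in> SG \<Longrightarrow> sgmap_word q w x \<in> SG"
  by (induction w) (auto intro: sgmap_in_SG)

text \<open>The fixed point of the contraction \<open>sgmap q i\<close> is the limit of its iterates
  from any point of the closed set \<open>SG\<close>.\<close>

lemma q_in_SG: "q i \<in> SG"
proof -
  obtain x where x: "x \<in> SG" using SG_ne by blast
  have "(\<lambda>m. dist x (q i) * (1/2) ^ m) \<longlonglongrightarrow> dist x (q i) * 0"
    by (intro tendsto_intros) auto
  moreover have "dist ((sgmap q i ^^ m) x) (q i) = dist x (q i) * (1/2) ^ m" for m
  proof (induction m)
    case (Suc m)
    have "dist ((sgmap q i ^^ Suc m) x) (q i) = dist ((sgmap q i ^^ m) x) (q i) / 2"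
      using dist_sgmap[of q i _ "q i"] by simp
    then show ?case using Suc by simp
  qed simp
  ultimately have "(\<lambda>m. (sgmap q i ^^ m) x) \<longlonglongrightarrow> q i"
    by (subst tendsto_dist_iff) simp
  moreover have "(sgmap q i ^^ m) x \<in> SG" for m
    using sgmap_word_in_SG[OF x] by (metis sgmap_word_replicate)
  ultimately show ?thesis
    by (rule closed_sequentially[OF compact_imp_closed[OF compact_SG], rotated])
qed

lemma vertices_subset_SG: "vertices q m \<subseteq> SG"
  by (induction m) (auto intro: q_in_SG sgmap_in_SG)

lemma q_eq_iff [simp]: "q i = q j \<longleftrightarrow> i = j"
  using equi by (force simp: equilateral_def)

text \<open>Barycentric coordinates: the gradient of the \<open>i\<close>-th one is a multiple of the median vector at \<open>q i\<close>.\<close>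

definition bary :: "3 \<Rightarrow> real^2 \<Rightarrow> real" where
  "bary i x = 1 + 2 / (3 * (dist (q 0) (q 1))\<^sup>2) * ((x - q i) \<bullet> (3 *\<^sub>R q i - (q 0 + q 1 + q 2)))"

lemma bary_q: "bary i (q j) = (if i = j then 1 else 0)"
  and sum_bary: "(\<Sum>i\<in>UNIV. bary i x) = 1"
proof -
  define s where "s = dist (q 0) (q 1)"
  have "s > 0" by (simp add: s_def)
  have ds: "dist (q i) (q j) = s" if "i \<noteq> j" for i j
  proof -
    have "(0::3) \<noteq> 1" by simp
    then show ?thesis using equi that unfolding equilateral_def s_def by metis
  qed
  define S where "S = q 0 + q 1 + q 2"
  define r where "r = 2 / (3 * s\<^sup>2)"
  have rs: "r * s\<^sup>2 = 2/3" using \<open>s > 0\<close> by (simp add: r_def)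
  have bary: "bary i x = 1 + r * ((x - q i) \<bullet> (3 *\<^sub>R q i - S))" for i x
    by (simp add: bary_def r_def s_def S_def)
  have nq: "q i \<bullet> q i - 2 * (q i \<bullet> q j) + q j \<bullet> q j = s\<^sup>2" if "i \<noteq> j" for i j
    unfolding ds[OF that, symmetric] dist_norm power2_norm_eq_inner
    by (simp add: inner_diff_left inner_diff_right inner_commute)
  note ns = nq[of 0 1] nq[of 0 2] nq[of 1 2]
  have sw: "q 1 \<bullet> q 0 = q 0 \<bullet> q 1" "q 2 \<bullet> q 0 = q 0 \<bullet> q 2" "q 2 \<bullet> q 1 = q 1 \<bullet> q 2"
    by (simp_all add: inner_commute)
  \<comment> \<open>The side lengths determine all differences of inner products. Multiplied by
    \<open>r\<close> the value is -1, so \<open>bary i\<close> falls from 1 at \<open>q i\<close> to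
    0 at the other corners.\<close>
  have off: "(q j - q i) \<bullet> (3 *\<^sub>R q i - S) = - 3 / 2 * s\<^sup>2" if "i \<noteq> j" for i j
  proof -
    have "\<forall>i j. i \<noteq> j \<longrightarrow> (q j - q i) \<bullet> (3 *\<^sub>R q i - S) = - 3 / 2 * s\<^sup>2"
      unfolding forall_3_eq using ns
      by (simp add: S_def inner_diff_left inner_diff_right inner_add_left inner_add_right sw)
    then show ?thesis using that by blast
  qed
  show "bary i (q j) = (if i = j then 1 else 0)"
  proof (cases "i = j")
    case False
    have "bary i (q j) = 1 - 3 / 2 * (r * s\<^sup>2)" unfolding bary off[OF False] by simp
    then show ?thesis using False rs by simp
  qed (simp add: bary)
  have "(x - q 0) \<bullet> (3 *\<^sub>R q 0 - S) + (x - q 1) \<bullet> (3 *\<^sub>R q 1 - S) + (x - q 2) \<bullet> (3 *\<^sub>R q 2 - S)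
      = - 3 * s\<^sup>2" using ns
    by (simp add: S_def inner_diff_left inner_diff_right inner_add_left inner_add_right sw algebra_simps)
  moreover have "(\<Sum>i\<in>UNIV. bary i x) = 3 + r * ((x - q 0) \<bullet> (3 *\<^sub>R q 0 - S) + (x - q 1) \<bullet> (3 *\<^sub>R q 1 - S) + (x - q 2) \<bullet> (3 *\<^sub>R q 2 - S))"
    unfolding sum_UNIV_3 bary by (simp add: algebra_simps)
  ultimately have "(\<Sum>i\<in>UNIV. bary i x) = 3 - 3 * (r * s\<^sup>2)" by simp
  then show "(\<Sum>i\<in>UNIV. bary i x) = 1" using rs by simp
qed

lemma bary_sgmap: "bary i (sgmap q j x) = (bary i x + (if i = j then 1 else 0)) / 2"
proof -
  have "sgmap q j x - q i = (1/2) *\<^sub>R ((x - q i) + (q j - q i))"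
    by (simp add: sgmap_def vec_eq_iff field_simps)
  then have "bary i (sgmap q j x) = (bary i x + bary i (q j)) / 2" unfolding bary_def
    by (simp only: inner_add_left inner_scaleR_left) (simp add: field_simps)
  then show ?thesis by (simp add: bary_q)
qed

lemma continuous_on_bary: "continuous_on T (bary i)"
  unfolding bary_def by (intro continuous_intros)

text \<open>A minimizer is \<open>sgmap q j z\<close> with \<open>z\<close> in \<open>SG\<close>, so
  by \<open>bary_sgmap\<close> the minimum is at least half of itself.\<close>

lemma bary_nonneg:
  assumes "x \<in> SG" shows "bary i x \<ge> 0"
proof -
  obtain y where y: "y \<in> SG" "\<And>z. z \<in> SG \<Longrightarrow> bary i y \<le> bary i z"
    using continuous_attains_inf[OF compact_SG SG_ne continuous_on_bary] by blast
  obtain j z where z: "z \<in> SG" "y = sgmap q j z" using sgmap_cases y(1) by blast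
  have "bary i y \<le> bary i z" using y z by blast
  then have "bary i y \<ge> 0" using bary_sgmap[of i j z] z by (auto split: if_splits)
  then show ?thesis using y(2)[OF assms] by simp
qed

lemma bary_le_1: "x \<in> SG \<Longrightarrow> bary i x \<le> 1"
  using member_le_sum[of i UNIV "\<lambda>i. bary i x"] bary_nonneg sum_bary[of x] by simp

text \<open>Take the farthest point from \<open>q i\<close> among those with coordinate 1. It is the
  image under \<open>sgmap q i\<close> of a point of the same kind at twice the distance, so that
  distance is 0.\<close>

lemma bary_eq_1D:
  assumes "x \<in> SG" "bary i x = 1" shows "x = q i"
proof -
  define A where "A = {x \<in> SG. bary i x = 1}"
  have "closed {x. bary i x = 1}"
    using continuous_on_bary[of UNIV] by (intro closed_Collect_eq) auto
  then have cA: "compact A" using compact_Int_closed[OF compact_SG] by (simp add: A_def Collect_conj_eq)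
  have "A \<noteq> {}" using assms A_def by auto
  moreover have "continuous_on A (\<lambda>y. dist y (q i))" by (intro continuous_intros)
  ultimately obtain y where y: "y \<in> A" "\<And>z. z \<in> A \<Longrightarrow> dist z (q i) \<le> dist y (q i)"
    using continuous_attains_sup[OF cA] by blast
  obtain j z where z: "z \<in> SG" "y = sgmap q j z" using sgmap_cases y(1) A_def by blast
  have "bary i y = (bary i z + (if i = j then 1 else 0)) / 2" using bary_sgmap z by simp
  then have ij: "i = j" "bary i z = 1" using y(1) bary_le_1[OF z(1), of i] by (auto simp: A_def split: if_splits)
  have "dist y (q i) = dist z (q i) / 2" using dist_sgmap[of q i z "q i"] z ij by simp
  moreover have "dist z (q i) \<le> dist y (q i)" using y(2) z ij by (auto simp: A_def)
  moreover have "dist x (q i) \<le> dist y (q i)" using y(2) assms by (auto simp: A_def)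
  ultimately have "dist x (q i) \<le> 0" by linarith
  then show ?thesis by simp
qed

text \<open>On the cell with index \<open>a\<close> the coordinate \<open>bary a\<close> is at least
  1/2, while it is 0 at the corners other than \<open>q a\<close>.\<close>

lemma q_in_cell: 
  assumes "q j \<in> sgmap q a ` SG" shows "a = j"
proof -
  obtain x where x: "x \<in> SG" "q j = sgmap q a x" using assms by blast
  then have "bary a (q j) = (bary a x + 1) / 2" using bary_sgmap by simp
  then show "a = j" using bary_q[of a j] bary_nonneg[OF x(1), of a] by (auto split: if_splits)
qed

text \<open>At a common point both \<open>bary a\<close> and \<open>bary b\<close> are at least 1/2
  and their sum is at most 1. So \<open>bary b\<close> is exactly 1/2 there, which means that it is
  1 at the preimage \<open>x\<close>.\<close>

lemma cells_meet:
  assumes "a \<noteq> b" "x \<in> SG" "y \<in> SG" "sgmap q a x = sgmap q b y"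
  shows "x = q b"
proof -
  let ?z = "sgmap q a x"
  have z: "?z \<in> SG" using assms sgmap_in_SG by blast
  have "bary a ?z = (bary a x + 1) / 2" "bary b ?z = bary b x / 2" 
    using bary_sgmap[of a a x] bary_sgmap[of b a x] \<open>a \<noteq> b\<close> by simp_all
  moreover have "bary b ?z = (bary b y + 1) / 2" using bary_sgmap[of b b y] assms by simp
  moreover have "sum (\<lambda>i. bary i ?z) {a, b} \<le> sum (\<lambda>i. bary i ?z) UNIV"
    using bary_nonneg[OF z] by (intro sum_mono2) auto
  then have "bary a ?z + bary b ?z \<le> 1" using sum_bary[of ?z] \<open>a \<noteq> b\<close> by simp
  ultimately have "bary b x = 1"
    using bary_nonneg[OF assms(2), of a] bary_nonneg[OF assms(3), of b] by argo
  then show ?thesis using bary_eq_1D assms by blast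
qed

lemma q_in_word_cell:
  assumes "x \<in> SG" "sgmap_word q w x = q j" shows "x = q j"
  using assms
proof (induction w)
  case (Cons a w)
  have "q j \<in> sgmap q a ` SG" using Cons.prems sgmap_word_in_SG[of x w] by force
  then have "a = j" by (rule q_in_cell)
  then have "sgmap_word q w x = q j" using Cons.prems sgmap_eq_iff[of q j _ "q j"] by simp
  then show ?case using Cons by blast
qed simp

text \<open>Strip the common prefix. At the first differing letters \<open>cells_meet\<close> makes
  the remaining image of \<open>x\<close> a corner of \<open>SG\<close>, and the preimage of such a
  corner in a cell is again that corner.\<close>

lemma word_cells_meet:
  assumes "length v = length w" "v \<noteq> w" "x \<in> SG" "y \<in> SG" "sgmap_word q v x = sgmap_word q w y"
  shows "\<exists>j. x = q j"
  using assms
proof (induction v w rule: list_induct2)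
  case (Cons a v b w)
  show ?case
  proof (cases "a = b")
    case False
    then have "sgmap_word q v x = q b"
      using cells_meet[of a b "sgmap_word q v x" "sgmap_word q w y"] Cons.prems sgmap_word_in_SG by simp
    then show ?thesis using q_in_word_cell Cons.prems by blast
  qed (use Cons in auto)
qed simp

text \<open>Links \<open>adjacent\<close>, which asks only for membership in a common cell, to the
  corners of that cell. A corner of another cell is covered by
  \<open>word_cells_meet\<close>.\<close>

lemma vertex_in_cell:
  assumes "x \<in> vertices q (length w)" "x \<in> sgmap_word q w ` SG"
  shows "\<exists>i. x = sgmap_word q w (q i)"
proof -
  obtain v i where v: "length v = length w" "x = sgmap_word q v (q i)"
    using assms(1) by (auto simp: vertices_eq)
  obtain y where y: "y \<in> SG" "x = sgmap_word q w y" using assms by blast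
  show ?thesis
  proof (cases "v = w")
    case False
    then have "\<exists>j. y = q j" using word_cells_meet[of w v y "q i"] v y q_in_SG by metis
    then show ?thesis using y by blast
  qed (use v in blast)
qed

text \<open>Distinct first-level cells meet in one point only, which cannot be the image of two
  different corners. This keeps the neighbours of a vertex from being counted twice.\<close>

lemma two_vertices_cell:
  assumes "length v = length w" "i \<noteq> j" "sgmap_word q v (q i) = sgmap_word q w (q i')"
    "sgmap_word q v (q j) = sgmap_word q w (q j')"
  shows "v = w"
  using assms
proof (induction v w rule: list_induct2)
  case (Cons a v b w)
  show ?case
  proof (cases "a = b")
    case False
    have "sgmap_word q v (q k) = q b" if "sgmap q a (sgmap_word q v (q k)) = sgmap q b (sgmap_word q w (q k'))" for k k'
      using cells_meet[OF False _ _ that] sgmap_word_in_SG q_in_SG by blast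
    then have "sgmap_word q v (q i) = q b" "sgmap_word q v (q j) = q b"
      using Cons.prems by (metis sgmap_word_Cons)+
    then show ?thesis using Cons.prems by (metis q_eq_iff sgmap_word_eq_iff)
  qed (use Cons in auto)
qed simp

lemma SG_words: "SG = (\<Union>w\<in>words m. sgmap_word q w ` SG)"
proof (induction m)
  case (Suc m)
  have "words (Suc m) = (\<Union>a. (#) a ` words m)" by (auto simp: length_Suc_conv)
  then have "(\<Union>w\<in>words (Suc m). sgmap_word q w ` SG) = (\<Union>a. sgmap q a ` (\<Union>w\<in>words m. sgmap_word q w ` SG))"
    by (auto simp: image_UN image_image)
  then show ?case using Suc SG_eq by simp
qed simp

lemma small_cells:
  assumes "e > 0"
  obtains M where "\<And>m w x y. M \<le> m \<Longrightarrow> length w = m \<Longrightarrow> x \<in> sgmap_word q w ` SG \<Longrightarrow> y \<in> sgmap_word q w ` SG \<Longrightarrow> dist x y < e"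
proof -
  obtain D where D: "D > 0" "\<And>x y. x \<in> SG \<Longrightarrow> y \<in> SG \<Longrightarrow> dist x y \<le> D"
  proof (rule that[of "diameter SG + 1"])
    show "diameter SG + 1 > 0" using diameter_ge_0[OF compact_imp_bounded[OF compact_SG]] by simp
    show "dist x y \<le> diameter SG + 1" if "x \<in> SG" "y \<in> SG" for x y
      using diameter_bounded_bound[OF compact_imp_bounded[OF compact_SG] that] by simp
  qed
  obtain M where M: "(1/2::real) ^ M < e / D" using real_arch_pow_inv[of "e / D" "1/2"] assms D by auto
  have "dist x y < e" if h: "M \<le> m" "length w = m" "x \<in> sgmap_word q w ` SG" "y \<in> sgmap_word q w ` SG" for m w x y
  proof -
    obtain x' y' where xy: "x' \<in> SG" "y' \<in> SG" "x = sgmap_word q w x'" "y = sgmap_word q w y'" using h by blast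
    have "dist x y = dist x' y' / 2 ^ m" using dist_sgmap_word xy h by simp
    also have "\<dots> \<le> D * (1/2) ^ m" using D(2)[OF xy(1,2)] by (simp add: field_simps power_divide)
    also have "\<dots> \<le> D * (1/2) ^ M" using D h by (simp add: power_decreasing)
    also have "\<dots> < e" using M D by (simp add: field_simps)
    finally show ?thesis .
  qed
  then show ?thesis using that by blast
qed

end

section \<open>Graph Laplacians\<close>

context gasket begin

abbreviation vtx :: "3 list \<Rightarrow> 3 \<Rightarrow> real^2" where
  "vtx w i \<equiv> sgmap_word q w (q i)"

lemma vtx_snoc: "vtx (w @ [i]) j = sgmap_word q w (sgmap q i (q j))"
  by (simp add: sgmap_word_append)

lemma vtx_snoc_same [simp]: "vtx (w @ [i]) i = vtx w i"
  by (simp add: vtx_snoc)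

lemma vtx_snoc_swap: "vtx (w @ [i]) j = vtx (w @ [j]) i"
  by (simp add: vtx_snoc sgmap_swap)

lemma vtx_in_vertices: "length w = m \<Longrightarrow> vtx w i \<in> vertices q m"
  unfolding vertices_eq by force

lemma finite_vertices [simp]: "finite (vertices q m)"
  unfolding vertices_eq by (intro finite_imageI finite_cartesian_product) auto

lemma vertices_Suc_mono: "vertices q m \<subseteq> vertices q (Suc m)"
proof
  fix x assume "x \<in> vertices q m"
  then obtain w i where w: "length w = m" "x = vtx w i" unfolding vertices_eq by auto
  then show "x \<in> vertices q (Suc m)" using vtx_in_vertices[of "w @ [i]" "Suc m" i] by simp
qed

lemma vertices_mono: "m \<le> n \<Longrightarrow> vertices q m \<subseteq> vertices q n"
  by (rule lift_Suc_mono_le[of "vertices q"]) (rule vertices_Suc_mono)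

text \<open>The incidences of a vertex: the cells of level m that have it as a corner, with the
  number of that corner. They turn sums over vertices into sums over cells.\<close>

definition inc :: "nat \<Rightarrow> real^2 \<Rightarrow> (3 list \<times> 3) set" where
  "inc m x = {(w, i). length w = m \<and> vtx w i = x}"

lemma finite_inc [simp]: "finite (inc m x)"
  by (rule finite_subset[of _ "words m \<times> UNIV"]) (auto simp: inc_def)

lemma sum_vertices: "(\<Sum>x\<in>vertices q m. \<Sum>(w, i)\<in>inc m x. h w i) = (\<Sum>w\<in>words m. \<Sum>i\<in>UNIV. h w i)"
proof -
  have "inc m x = {z \<in> words m \<times> UNIV. (case z of (w, i) \<Rightarrow> vtx w i) = x}" for x
    by (auto simp: inc_def)
  then have "(\<Sum>x\<in>vertices q m. \<Sum>(w, i)\<in>inc m x. h w i)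
    = (\<Sum>x\<in>vertices q m. \<Sum>(w, i)\<in>{z \<in> words m \<times> UNIV. (case z of (w, i) \<Rightarrow> vtx w i) = x}. h w i)" by simp
  also have "\<dots> = (\<Sum>(w, i)\<in>words m \<times> UNIV. h w i)"
    by (rule sum.group) (auto simp: vertices_eq)
  also have "\<dots> = (\<Sum>w\<in>words m. \<Sum>i\<in>UNIV. h w i)" by (simp add: sum.cartesian_product)
  finally show ?thesis .
qed

lemma midpoint_not_corner: "i \<noteq> j \<Longrightarrow> sgmap q i (q j) \<noteq> q k"
  by (metis q_in_cell q_in_SG imageI sgmap_eq_iff sgmap_fixpoint q_eq_iff)

text \<open>The two listed incidences come from \<open>sgmap_swap\<close>. A cell below another
  parent \<open>w'\<close> would, by \<open>word_cells_meet\<close>, force the midpoint to be a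
  corner of \<open>SG\<close>.\<close>

lemma inc_midpoint:
  assumes "length w = m" "a \<noteq> b"
  shows "inc (Suc m) (vtx (w @ [a]) b) = {(w @ [a], b), (w @ [b], a)}"
proof (intro set_eqI iffI)
  fix z assume "z \<in> inc (Suc m) (vtx (w @ [a]) b)"
  then obtain v i where z: "z = (v, i)" "length v = Suc m" "vtx v i = vtx (w @ [a]) b" by (auto simp: inc_def)
  then obtain w' c where v: "v = w' @ [c]" "length w' = m" by (metis append_butlast_last_id length_butlast diff_Suc_1 length_0_conv nat.distinct(1))
  have eq: "sgmap_word q w (sgmap q a (q b)) = sgmap_word q w' (sgmap q c (q i))"
    using z v by (simp add: vtx_snoc)
  have "w' = w"
  proof (rule ccontr)
    assume "w' \<noteq> w"
    then have "\<exists>j. sgmap q a (q b) = q j"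
      using word_cells_meet[of w w' "sgmap q a (q b)" "sgmap q c (q i)"] eq v assms q_in_SG sgmap_in_SG by metis
    then show False using midpoint_not_corner assms by blast
  qed
  then have eq': "sgmap q a (q b) = sgmap q c (q i)" using eq by simp
  show "z \<in> {(w @ [a], b), (w @ [b], a)}"
  proof (cases "c = a")
    case True
    then show ?thesis using eq' z v \<open>w' = w\<close> by simp
  next
    case False
    then have "q b = q c" "q i = q a"
      using cells_meet[of a c "q b" "q i"] cells_meet[of c a "q i" "q b"] eq' q_in_SG by auto
    then show ?thesis using z v \<open>w' = w\<close> by simp
  qed
qed (use assms in \<open>auto simp: inc_def vtx_snoc_swap\<close>)

lemma midpoint_not_vertex:
  assumes "length w = m" "a \<noteq> b" shows "vtx (w @ [a]) b \<notin> vertices q m"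
proof
  assume "vtx (w @ [a]) b \<in> vertices q m"
  then have "\<exists>i. vtx (w @ [a]) b = vtx w i"
    using vertex_in_cell[of "vtx (w @ [a]) b" w] assms q_in_SG sgmap_in_SG by (auto simp: vtx_snoc)
  then show False using midpoint_not_corner assms by (auto simp: vtx_snoc)
qed

text \<open>Corner i of a cell stays corner i of its subcell i. The other corners of subcells are
  midpoints, and these are new vertices.\<close>

lemma inc_Suc_vertex:
  assumes "x \<in> vertices q m"
  shows "inc (Suc m) x = (\<lambda>(w, i). (w @ [i], i)) ` inc m x"
proof (intro set_eqI iffI)
  fix z assume "z \<in> inc (Suc m) x"
  then obtain v i where z: "z = (v, i)" "length v = Suc m" "vtx v i = x" by (auto simp: inc_def)
  then obtain w c where v: "v = w @ [c]" "length w = m" by (metis append_butlast_last_id length_butlast diff_Suc_1 length_0_conv nat.distinct(1))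
  have "c = i" using midpoint_not_vertex[of w m c i] v z assms by blast
  then have "(w, i) \<in> inc m x" using z v by (auto simp: inc_def)
  then show "z \<in> (\<lambda>(w, i). (w @ [i], i)) ` inc m x" using z v \<open>c = i\<close> by force
qed (auto simp: inc_def)

text \<open>An interior vertex arises as a midpoint, with two incidences, and keeps their number at
  all later levels.\<close>

lemma card_inc:
  "x \<in> vertices q m \<Longrightarrow> x \<notin> vertices q 0 \<Longrightarrow> card (inc m x) = 2"
proof (induction m)
  case (Suc m)
  show ?case
  proof (cases "x \<in> vertices q m")
    case True
    have "inj_on (\<lambda>(w, i). (w @ [i], i)) (inc m x)" by (auto simp: inj_on_def)
    then show ?thesis using Suc True inc_Suc_vertex[OF True] by (simp add: card_image)
  next
    case False
    obtain v b where v: "length v = Suc m" "x = vtx v b" using Suc.prems(1) unfolding vertices_eq by auto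
    then obtain w a where w: "v = w @ [a]" "length w = m" by (metis append_butlast_last_id length_butlast diff_Suc_1 length_0_conv nat.distinct(1))
    have "a \<noteq> b" using False v w vtx_in_vertices by force
    then show ?thesis using inc_midpoint[of w m a b] v w by simp
  qed
qed simp

text \<open>A neighbour is another corner of an incident cell. By \<open>two_vertices_cell\<close>
  no neighbour arises from two different cells, so the parametrization is injective.\<close>

lemma sum_adjacent:
  assumes "x \<in> vertices q m"
  shows "(\<Sum>y | adjacent q SG m x y. h y) = (\<Sum>(w, i)\<in>inc m x. \<Sum>j\<in>UNIV - {i}. h (vtx w j))"
proof -
  let ?T = "SIGMA z:inc m x. UNIV - {snd z}"
  let ?g = "\<lambda>(z, j). vtx (fst z) j"
  have inj: "inj_on ?g ?T"
  proof (rule inj_onI)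
    fix s t assume st: "s \<in> ?T" "t \<in> ?T" "?g s = ?g t"
    obtain v i j where s: "s = ((v, i), j)" by (metis surj_pair)
    obtain w i' j' where t: "t = ((w, i'), j')" by (metis surj_pair)
    have "vtx v i = x" "vtx w i' = x" "length v = m" "length w = m" "i \<noteq> j" "vtx v j = vtx w j'"
      using st s t by (auto simp: inc_def)
    moreover from this have "v = w" using two_vertices_cell[of v w i j i' j'] by simp
    ultimately show "s = t" using s t by (metis q_eq_iff sgmap_word_eq_iff)
  qed
  have img: "{y. adjacent q SG m x y} = ?g ` ?T"
  proof (intro set_eqI iffI)
    fix y assume "y \<in> {y. adjacent q SG m x y}"
    then obtain w where w: "y \<in> vertices q m" "x \<noteq> y" "length w = m" "x \<in> sgmap_word q w ` SG" "y \<in> sgmap_word q w ` SG"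
      by (auto simp: adjacent_def)
    obtain i j where "x = vtx w i" "y = vtx w j" using vertex_in_cell w assms by metis
    then have "((w, i), j) \<in> ?T" "y = ?g ((w, i), j)" using w by (auto simp: inc_def)
    then show "y \<in> ?g ` ?T" by blast
  next
    fix y assume "y \<in> ?g ` ?T"
    then obtain z j where "z \<in> inc m x" "j \<noteq> snd z" "y = vtx (fst z) j" by auto
    then obtain w i where w: "length w = m" "x = vtx w i" "i \<noteq> j" "y = vtx w j"
      by (cases z) (auto simp: inc_def)
    then show "y \<in> {y. adjacent q SG m x y}"
      using vtx_in_vertices q_in_SG by (auto simp: adjacent_def)
  qed
  have "(\<Sum>y | adjacent q SG m x y. h y) = (\<Sum>t\<in>?T. h (?g t))"
    unfolding img by (simp add: sum.reindex[OF inj])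
  also have "\<dots> = (\<Sum>z\<in>inc m x. \<Sum>j\<in>UNIV - {snd z}. h (vtx (fst z) j))"
    by (subst sum.Sigma) (auto simp: case_prod_beta)
  finally show ?thesis by (simp add: case_prod_beta)
qed

text \<open>The graph Laplacian without its scaling factor. The term with j = i is zero, so it need
  not be excluded from the sum.\<close>

definition vsum :: "nat \<Rightarrow> (real^2 \<Rightarrow> real) \<Rightarrow> real^2 \<Rightarrow> real" where
  "vsum m u x = (\<Sum>(w, i)\<in>inc m x. \<Sum>j\<in>UNIV. u (vtx w j) - u x)"

lemma graph_laplacian_eq:
  assumes "x \<in> vertices q m"
  shows "graph_laplacian q SG m u x = 3/2 * 5 ^ m * vsum m u x"
proof -
  have "(\<Sum>j\<in>UNIV - {i}. u (vtx w j) - u x) = (\<Sum>j\<in>UNIV. u (vtx w j) - u x)" if "(w, i) \<in> inc m x" for w i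
    using that by (intro sum.mono_neutral_left) (auto simp: inc_def)
  then have "(\<Sum>y | adjacent q SG m x y. u y - u x) = vsum m u x"
    unfolding sum_adjacent[OF assms] vsum_def by (intro sum.cong) auto
  then show ?thesis by (simp add: graph_laplacian_def)
qed

lemma abs_graph_laplacian_eq:
  assumes "x \<in> vertices q m"
  shows "\<bar>graph_laplacian q SG m u x\<bar> = 3/2 * 5 ^ m * \<bar>vsum m u x\<bar>"
  unfolding graph_laplacian_eq[OF assms] abs_mult by simp

lemma vsum_midpoint:
  assumes "length w = m" "a \<noteq> b"
  shows "vsum (Suc m) u (vtx (w @ [a]) b) =
    (\<Sum>k\<in>UNIV. u (vtx (w @ [a]) k) - u (vtx (w @ [a]) b)) + (\<Sum>k\<in>UNIV. u (vtx (w @ [b]) k) - u (vtx (w @ [a]) b))"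
  unfolding vsum_def inc_midpoint[OF assms] using assms(2) by simp

lemma vsum_Suc:
  assumes "x \<in> vertices q m"
  shows "vsum (Suc m) u x = (\<Sum>(w, i)\<in>inc m x. \<Sum>j\<in>UNIV. u (vtx (w @ [i]) j) - u x)"
  unfolding vsum_def inc_Suc_vertex[OF assms]
  by (subst sum.reindex) (auto simp: inj_on_def case_prod_beta)

text \<open>Eliminating the midpoints of a cell from the level \<open>m + 1\<close> sums, with weights \<open>2/5\<close> (adjacent
  midpoints) and \<open>1/5\<close> (opposite midpoint), leaves \<open>3/5\<close> of the level \<open>m\<close> sum.\<close>

lemma cell_renormalization:
  assumes w: "length w = m" and A: "\<And>a b. a \<noteq> b \<Longrightarrow> \<bar>vsum (Suc m) u (vtx (w @ [a]) b)\<bar> \<le> A"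
  shows "\<bar>3/5 * (\<Sum>j\<in>UNIV. u (vtx w j) - u (vtx w i)) - (\<Sum>j\<in>UNIV. u (vtx (w @ [i]) j) - u (vtx w i))\<bar> \<le> A"
proof -
  define m where "m i j = u (vtx (w @ [i]) j)" for i j
  have m: "m 1 0 = m 0 1" "m 2 0 = m 0 2" "m 2 1 = m 1 2" "u (vtx w j) = m j j" for j
    using vtx_snoc_swap[of w 1 0] vtx_snoc_swap[of w 2 0] vtx_snoc_swap[of w 2 1] by (simp_all add: m_def)
  have s: "(\<Sum>k\<in>UNIV. h k - r) = h 0 + h 1 + h 2 - 3 * r" for h :: "3 \<Rightarrow> real" and r
    by (simp add: sum_UNIV_3)
  have L: "\<bar>m a 0 + m a 1 + m a 2 - 3 * m a b + (m b 0 + m b 1 + m b 2 - 3 * m a b)\<bar> \<le> A" if "a \<noteq> b" for a b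
    using A[OF that] unfolding vsum_midpoint[OF w that] m_def s .
  have "\<forall>i. \<bar>3/5 * (m 0 0 + m 1 1 + m 2 2 - 3 * m i i) - (m i 0 + m i 1 + m i 2 - 3 * m i i)\<bar> \<le> A"
  proof -
    have "(0::3) \<noteq> 1" "(0::3) \<noteq> 2" "(1::3) \<noteq> 2" by simp_all
    \<comment> \<open>The weights 2/5, 2/5, 1/5 add up to 1, so the bound \<open>A\<close> is
      reproduced without loss.\<close>
    note L' = L[OF this(1)] L[OF this(2)] L[OF this(3)]
    show ?thesis
      using L' unfolding forall_3_eq m(1-3) abs_le_iff
      by (elim conjE, intro conjI) (simp_all add: field_simps)
  qed
  then have "\<forall>i. \<bar>3/5 * (\<Sum>j\<in>UNIV. u (vtx w j) - u (vtx w i)) - (\<Sum>j\<in>UNIV. u (vtx (w @ [i]) j) - u (vtx w i))\<bar> \<le> A"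
    unfolding s m(4) m_def .
  then show ?thesis by blast
qed

text \<open>Each of the two cells at \<open>x\<close> contributes an error \<open>A\<close>, and the
  level m + 1 sum at \<open>x\<close> itself a third one. So 3/5 of the level m sum is at most
  \<open>3 * A\<close>, and the resulting factor 5 is exactly the ratio of the two scaling
  factors.\<close>

lemma graph_laplacian_bound_down:
  assumes "\<And>x. x \<in> vertices q (Suc m) - vertices q 0 \<Longrightarrow> \<bar>graph_laplacian q SG (Suc m) u x\<bar> \<le> e"
    and x: "x \<in> vertices q m - vertices q 0"
  shows "\<bar>graph_laplacian q SG m u x\<bar> \<le> e"
proof -
  define A where "A = e / (3/2 * 5 ^ Suc m)"
  have A: "\<bar>vsum (Suc m) u y\<bar> \<le> A" if "y \<in> vertices q (Suc m) - vertices q 0" for y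
    using assms(1)[OF that] abs_graph_laplacian_eq[of y "Suc m" u] that
    by (simp add: A_def field_simps del: vertices.simps)
  have mid: "vtx (w @ [a]) b \<in> vertices q (Suc m) - vertices q 0" if "a \<noteq> b" "length w = m" for w a b
    using midpoint_not_vertex[of w m a b] vtx_in_vertices[of "w @ [a]" "Suc m" b] vertices_mono[of 0 m] that by auto
  have "\<bar>3/5 * vsum m u x - vsum (Suc m) u x\<bar> \<le> (\<Sum>(w, i)\<in>inc m x. A)"
  proof -
    have "3/5 * vsum m u x - vsum (Suc m) u x = (\<Sum>(w, i)\<in>inc m x. 3/5 * (\<Sum>j\<in>UNIV. u (vtx w j) - u x) - (\<Sum>j\<in>UNIV. u (vtx (w @ [i]) j) - u x))"
    proof -
      have "3/5 * vsum m u x = (\<Sum>z\<in>inc m x. 3/5 * (case z of (w, i) \<Rightarrow> \<Sum>j\<in>UNIV. u (vtx w j) - u x))"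
        unfolding vsum_def by (rule sum_distrib_left)
      moreover have "x \<in> vertices q m" using x by blast
      ultimately show ?thesis
        by (simp only: vsum_Suc sum_subtractf[symmetric] case_prod_unfold)
    qed
    also have "\<bar>\<dots>\<bar> \<le> (\<Sum>(w, i)\<in>inc m x. A)"
    proof (rule order_trans[OF sum_abs], rule sum_mono)
      fix z assume z: "z \<in> inc m x"
      obtain w i where wi: "z = (w, i)" by fastforce
      with z have "length w = m" "vtx w i = x" by (auto simp: inc_def)
      then show "\<bar>case z of (w, i) \<Rightarrow> 3/5 * (\<Sum>j\<in>UNIV. u (vtx w j) - u x) - (\<Sum>j\<in>UNIV. u (vtx (w @ [i]) j) - u x)\<bar> \<le> (case z of (w, i) \<Rightarrow> A)"
        using cell_renormalization[of w m u A i] A mid wi by auto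
    qed
    finally show ?thesis .
  qed
  also have "\<dots> = 2 * A" using card_inc x by simp
  finally have "\<bar>3/5 * vsum m u x\<bar> \<le> 3 * A" using A[of x] x vertices_Suc_mono by fastforce
  then have "\<bar>vsum m u x\<bar> \<le> 5 * A" by simp
  also have "\<dots> = e / (3/2 * 5 ^ m)" by (simp add: A_def)
  finally show ?thesis using x abs_graph_laplacian_eq[of x m u] by (simp add: field_simps)
qed

text \<open>Uniform convergence gives every bound \<open>e\<close> at deep levels, and
  \<open>graph_laplacian_bound_down\<close> carries it to level m unchanged.\<close>

lemma harmonic_exact:
  assumes "has_laplacian q SG u (\<lambda>x. 0)" and x: "x \<in> vertices q m - vertices q 0"
  shows "vsum m u x = 0"
proof -
  have "\<bar>graph_laplacian q SG m u x\<bar> \<le> e" if "e > 0" for e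
  proof -
    have "\<exists>M. \<forall>m\<ge>M. \<forall>x \<in> vertices q m - vertices q 0. \<bar>graph_laplacian q SG m u x\<bar> < e"
      using assms(1) that unfolding has_laplacian_def diff_zero by blast
    then obtain M where M: "\<And>m x. m \<ge> M \<Longrightarrow> x \<in> vertices q m - vertices q 0 \<Longrightarrow> \<bar>graph_laplacian q SG m u x\<bar> < e"
      by blast
    \<comment> \<open>Descending induction from \<open>max m M\<close>, a level where the bound is
      available.\<close>
    have "\<forall>x \<in> vertices q m - vertices q 0. \<bar>graph_laplacian q SG m u x\<bar> \<le> e" if "m \<le> max m M" for m
      using that
    proof (induction rule: inc_induct)
      case base
      show ?case using M[OF max.cobounded2] by (intro ballI less_imp_le)
    next
      case (step n)
      show ?case by (rule ballI, rule graph_laplacian_bound_down) (use step.IH in blast)+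
    qed
    then show ?thesis using x by simp
  qed
  then have "\<bar>graph_laplacian q SG m u x\<bar> \<le> 0" by (rule dense_ge)
  then show ?thesis using graph_laplacian_eq[of x m u] x by simp
qed

text \<open>Solves the three midpoint equations of a cell. Only the two edges at corner 0 are
  recorded, since they drive the recursion towards \<open>q 0\<close>.\<close>

lemma harmonic_midpoint:
  assumes "\<And>x. x \<in> vertices q (Suc m) - vertices q 0 \<Longrightarrow> vsum (Suc m) u x = 0" and w: "length w = m"
  shows "5 * u (vtx (w @ [0]) 1) = 2 * u (vtx w 0) + 2 * u (vtx w 1) + u (vtx w 2)"
    "5 * u (vtx (w @ [0]) 2) = 2 * u (vtx w 0) + 2 * u (vtx w 2) + u (vtx w 1)"
proof -
  have mid: "vtx (w @ [a]) b \<in> vertices q (Suc m) - vertices q 0" if "a \<noteq> b" for a b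
    using midpoint_not_vertex[of w m a b] vtx_in_vertices[of "w @ [a]" "Suc m" b] vertices_mono[of 0 m] that w by auto
  note z = assms(1)[OF mid]
  show "5 * u (vtx (w @ [0]) 1) = 2 * u (vtx w 0) + 2 * u (vtx w 1) + u (vtx w 2)"
    "5 * u (vtx (w @ [0]) 2) = 2 * u (vtx w 0) + 2 * u (vtx w 2) + u (vtx w 1)"
    using z[of 0 1] z[of 0 2] z[of 1 2] vtx_snoc_swap[of w 1 0] vtx_snoc_swap[of w 2 0] vtx_snoc_swap[of w 2 1]
    by (simp_all add: vsum_midpoint[OF w] sum_UNIV_3)
qed

end

section \<open>The Laplacian and derivatives at a corner\<close>

context gasket begin

text \<open>The Laplacian gives information only off \<open>vertices q 0\<close>, so density is
  needed without the boundary. Midpoints of small cells provide it.\<close>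

lemma closure_vertices: "closure (\<Union>m. vertices q m - vertices q 0) = SG"
proof (rule antisym)
  show "closure (\<Union>m. vertices q m - vertices q 0) \<subseteq> SG"
    using vertices_subset_SG compact_imp_closed[OF compact_SG] by (intro closure_minimal) blast+
  show "SG \<subseteq> closure (\<Union>m. vertices q m - vertices q 0)"
  proof
    fix x assume x: "x \<in> SG"
    show "x \<in> closure (\<Union>m. vertices q m - vertices q 0)"
    proof (unfold closure_approachable, intro allI impI)
      fix e :: real assume "e > 0"
      then obtain M where M: "\<And>m w x y. M \<le> m \<Longrightarrow> length w = m \<Longrightarrow> x \<in> sgmap_word q w ` SG \<Longrightarrow> y \<in> sgmap_word q w ` SG \<Longrightarrow> dist x y < e"
        using small_cells by blast
      obtain w where w: "length w = M" "x \<in> sgmap_word q w ` SG"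
        using x SG_words[of M] by blast
      let ?y = "vtx (w @ [0]) 1"
      have "(0::3) \<noteq> 1" by simp
      then have "?y \<notin> vertices q 0" using midpoint_not_vertex[OF w(1)] vertices_mono[of 0 M] by blast
      moreover have "?y \<in> vertices q (Suc M)" using w by (intro vtx_in_vertices) simp
      moreover have "?y \<in> sgmap_word q w ` SG" using q_in_SG sgmap_in_SG by (simp add: vtx_snoc)
      then have "dist ?y x < e" using M[OF order_refl w(1) _ w(2)] by blast
      ultimately show "\<exists>y\<in>\<Union>m. vertices q m - vertices q 0. dist y x < e" by blast
    qed
  qed
qed

lemma vanish_on_SG:
  assumes "continuous_on SG h" "\<And>m x. x \<in> vertices q m - vertices q 0 \<Longrightarrow> h x = (0::real)" "x \<in> SG"
  shows "h x = 0"
  using continuous_constant_on_closure[of "\<Union>m. vertices q m - vertices q 0" h 0 x] assms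
  unfolding closure_vertices by blast

lemma graph_laplacian_cong:
  assumes "\<And>x. x \<in> SG \<Longrightarrow> u x = v x" "x \<in> vertices q m"
  shows "graph_laplacian q SG m u x = graph_laplacian q SG m v x"
proof -
  have "adjacent q SG m x y \<Longrightarrow> y \<in> SG" for y
    using vertices_subset_SG by (auto simp: adjacent_def)
  then show ?thesis unfolding graph_laplacian_def
    using assms vertices_subset_SG[of m] by (intro arg_cong2[where f="(*)"] sum.cong) auto
qed

lemma has_laplacian_cong:
  assumes "has_laplacian q SG u f" "\<And>x. x \<in> SG \<Longrightarrow> u x = u' x" "\<And>x. x \<in> SG \<Longrightarrow> f x = f' x"
  shows "has_laplacian q SG u' f'"
proof -
  have "continuous_on SG u'" "continuous_on SG f'"
    using assms continuous_on_cong[OF refl, of SG u u'] continuous_on_cong[OF refl, of SG f f'] by (auto simp: has_laplacian_def)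
  moreover have "\<bar>graph_laplacian q SG m u' x - f' x\<bar> = \<bar>graph_laplacian q SG m u x - f x\<bar>"
    if "x \<in> vertices q m - vertices q 0" for m x
    using that graph_laplacian_cong[of u' u x m] assms vertices_subset_SG[of m] by auto
  ultimately show ?thesis using assms(1) unfolding has_laplacian_def by simp
qed

lemma has_laplacian_zero: "has_laplacian q SG (\<lambda>x. 0) (\<lambda>x. 0)"
  by (auto simp: has_laplacian_def graph_laplacian_def)

lemma graph_laplacian_lincomb:
  "graph_laplacian q SG m (\<lambda>x. a * u x + b * v x) x = a * graph_laplacian q SG m u x + b * graph_laplacian q SG m v x"
proof -
  have "(\<Sum>y | adjacent q SG m x y. a * u y + b * v y - (a * u x + b * v x))
    = a * (\<Sum>y | adjacent q SG m x y. u y - u x) + b * (\<Sum>y | adjacent q SG m x y. v y - v x)"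
    unfolding sum_distrib_left sum.distrib[symmetric] by (intro sum.cong) (auto simp: algebra_simps)
  then show ?thesis unfolding graph_laplacian_def by (simp add: algebra_simps)
qed

lemma has_laplacian_lincomb:
  assumes "has_laplacian q SG u f" "has_laplacian q SG v g"
  shows "has_laplacian q SG (\<lambda>x. a * u x + b * v x) (\<lambda>x. a * f x + b * g x)"
  unfolding has_laplacian_def
proof (intro conjI allI impI)
  show "continuous_on SG (\<lambda>x. a * u x + b * v x)" "continuous_on SG (\<lambda>x. a * f x + b * g x)"
    using assms by (auto simp: has_laplacian_def intro!: continuous_intros)
  fix e :: real assume "e > 0"
  define d where "d = e / (\<bar>a\<bar> + \<bar>b\<bar> + 1)"
  have d: "d > 0" "(\<bar>a\<bar> + \<bar>b\<bar>) * d < e" using \<open>e > 0\<close> by (auto simp: d_def field_simps add_pos_nonneg)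
  obtain M where M: "\<forall>m\<ge>M. \<forall>x \<in> vertices q m - vertices q 0. \<bar>graph_laplacian q SG m u x - f x\<bar> < d"
    using assms(1) d(1) unfolding has_laplacian_def by blast
  obtain N where N: "\<forall>m\<ge>N. \<forall>x \<in> vertices q m - vertices q 0. \<bar>graph_laplacian q SG m v x - g x\<bar> < d"
    using assms(2) d(1) unfolding has_laplacian_def by blast
  have "\<bar>graph_laplacian q SG m (\<lambda>x. a * u x + b * v x) x - (a * f x + b * g x)\<bar> < e"
    if m: "m \<ge> max M N" and x: "x \<in> vertices q m - vertices q 0" for m x
  proof -
    let ?U = "graph_laplacian q SG m u x - f x" and ?V = "graph_laplacian q SG m v x - g x"
    have UV: "\<bar>?U\<bar> \<le> d" "\<bar>?V\<bar> \<le> d" using M N m x by (auto intro: less_imp_le simp del: vertices.simps)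
    have "\<bar>a * ?U + b * ?V\<bar> \<le> \<bar>a\<bar> * \<bar>?U\<bar> + \<bar>b\<bar> * \<bar>?V\<bar>" by (metis abs_mult abs_triangle_ineq)
    also have "\<dots> \<le> \<bar>a\<bar> * d + \<bar>b\<bar> * d" using UV by (intro add_mono mult_left_mono) auto
    finally show ?thesis unfolding graph_laplacian_lincomb using d(2) by (simp add: algebra_simps)
  qed
  then show "\<exists>M. \<forall>m\<ge>M. \<forall>x \<in> vertices q m - vertices q 0.
    \<bar>graph_laplacian q SG m (\<lambda>x. a * u x + b * v x) x - (a * f x + b * g x)\<bar> < e" by blast
qed

lemma has_laplacian_of_zero:
  assumes "has_laplacian q SG (\<lambda>x. 0) h" "x \<in> SG"
  shows "h x = 0"
proof (rule vanish_on_SG[OF _ _ assms(2)])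
  show "continuous_on SG h" using assms(1) by (simp add: has_laplacian_def)
  fix m x assume x: "x \<in> vertices q m - vertices q 0"
  have "\<bar>h x\<bar> \<le> e" if "e > 0" for e
  proof -
    obtain M where M: "\<forall>m\<ge>M. \<forall>x \<in> vertices q m - vertices q 0. \<bar>graph_laplacian q SG m (\<lambda>x. 0) x - h x\<bar> < e"
      using assms(1) \<open>e > 0\<close> unfolding has_laplacian_def by blast
    have "x \<in> vertices q (max M m) - vertices q 0" using x vertices_mono[of m "max M m"] by auto
    then have "\<bar>graph_laplacian q SG (max M m) (\<lambda>x. 0) x - h x\<bar> < e" using M by (metis max.cobounded1)
    then show ?thesis by (simp add: graph_laplacian_def)
  qed
  then have "\<bar>h x\<bar> \<le> 0" by (rule dense_ge)
  then show "h x = 0" by simp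
qed

lemma has_laplacian_unique:
  assumes "has_laplacian q SG u f" "has_laplacian q SG u g" "x \<in> SG"
  shows "f x = g x"
  using has_laplacian_of_zero[OF _ assms(3)] has_laplacian_lincomb[OF assms(1,2), of 1 "-1"] by force

lemma has_laplacian_pow_cong:
  assumes "has_laplacian_pow q SG n u f" "\<And>x. x \<in> SG \<Longrightarrow> u x = u' x" "\<And>x. x \<in> SG \<Longrightarrow> f x = f' x"
  shows "has_laplacian_pow q SG n u' f'"
  using assms
proof (induction n arbitrary: f f')
  case (Suc n)
  then obtain g where g: "has_laplacian_pow q SG n u g" "has_laplacian q SG g f" by auto
  have "has_laplacian_pow q SG n u' g" using Suc.IH[OF g(1)] Suc.prems by blast
  moreover have "has_laplacian q SG g f'" using has_laplacian_cong[OF g(2)] Suc.prems by blast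
  ultimately show ?case by auto
qed simp

lemma has_laplacian_pow_unique:
  assumes "has_laplacian_pow q SG n u f" "has_laplacian_pow q SG n u g" "x \<in> SG"
  shows "f x = g x"
  using assms
proof (induction n arbitrary: f g x)
  case (Suc n)
  then obtain f' g' where fg: "has_laplacian_pow q SG n u f'" "has_laplacian q SG f' f"
    "has_laplacian_pow q SG n u g'" "has_laplacian q SG g' g" by auto
  have "has_laplacian q SG f' g" using has_laplacian_cong[OF fg(4)] Suc.IH[OF fg(3) fg(1)] by blast
  then show ?case using has_laplacian_unique fg(2) Suc.prems by blast
qed simp

lemma has_laplacian_pow_lincomb:
  assumes "has_laplacian_pow q SG n u f" "has_laplacian_pow q SG n v g"
  shows "has_laplacian_pow q SG n (\<lambda>x. a * u x + b * v x) (\<lambda>x. a * f x + b * g x)"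
  using assms
proof (induction n arbitrary: f g)
  case (Suc n)
  then show ?case unfolding has_laplacian_pow.simps(2) using has_laplacian_lincomb by blast
qed simp

lemma has_laplacian_pow_zero: "has_laplacian_pow q SG n (\<lambda>x. 0) (\<lambda>x. 0)"
  by (induction n) (auto intro: has_laplacian_zero)

text \<open>The defining recursion splits off the last Laplacian; comparing a monomial with its
  predecessor requires splitting off the first one.\<close>

lemma has_laplacian_pow_Suc_left:
  "has_laplacian_pow q SG (Suc n) u f \<longleftrightarrow> (\<exists>g. has_laplacian q SG u g \<and> has_laplacian_pow q SG n g f)"
proof (induction n arbitrary: f)
  case 0
  show ?case
  proof
    assume "has_laplacian_pow q SG (Suc 0) u f"
    then obtain g where "\<forall>x\<in>SG. g x = u x" "has_laplacian q SG g f" by auto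
    then have "has_laplacian q SG u f" using has_laplacian_cong by blast
    then show "\<exists>g. has_laplacian q SG u g \<and> has_laplacian_pow q SG 0 g f" by auto
  next
    assume "\<exists>g. has_laplacian q SG u g \<and> has_laplacian_pow q SG 0 g f"
    then obtain g where "has_laplacian q SG u g" "\<forall>x\<in>SG. f x = g x" by auto
    then have "has_laplacian q SG u f" using has_laplacian_cong[of u g u f] by simp
    then show "has_laplacian_pow q SG (Suc 0) u f" by auto
  qed
next
  case (Suc n)
  show ?case by (subst has_laplacian_pow.simps(2), subst Suc.IH) auto
qed

lemma has_laplacian_pow_vanish_mono:
  assumes "has_laplacian_pow q SG n u (\<lambda>x. 0)" "n \<le> m"
  shows "has_laplacian_pow q SG m u (\<lambda>x. 0)"
  using assms(2,1) by (induction m rule: dec_induct) (use has_laplacian_zero in auto)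

lemma has_laplacian_pow_sum:
  fixes k :: nat
  assumes "\<And>l. l < k \<Longrightarrow> has_laplacian_pow q SG n (u l) (f l)"
  shows "has_laplacian_pow q SG n (\<lambda>x. \<Sum>l<k. c l * u l x) (\<lambda>x. \<Sum>l<k. c l * f l x)"
  using assms
proof (induction k)
  case (Suc k)
  have "has_laplacian_pow q SG n (\<lambda>x. \<Sum>l<k. c l * u l x) (\<lambda>x. \<Sum>l<k. c l * f l x)"
    using Suc by simp
  from has_laplacian_pow_lincomb[OF this Suc.prems[of k], of 1 "c k"] show ?case by simp
qed (simp add: has_laplacian_pow_zero)

lemma corner_in_SG: "(sgmap q i ^^ m) (q j) \<in> SG"
  using sgmap_word_in_SG[OF q_in_SG] by (metis sgmap_word_replicate)

lemma has_tangential_deriv_cong: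
  assumes "has_tangential_deriv q u a" "\<And>x. x \<in> SG \<Longrightarrow> u x = v x"
  shows "has_tangential_deriv q v a"
  using assms(1) unfolding has_tangential_deriv_def by (simp add: assms(2) corner_in_SG)

lemma has_normal_deriv_lincomb:
  assumes "has_normal_deriv q u s" "has_normal_deriv q v t"
  shows "has_normal_deriv q (\<lambda>x. a * u x + b * v x) (a * s + b * t)"
proof -
  note l = tendsto_add[OF tendsto_mult_left[OF assms(1)[unfolded has_normal_deriv_def], of a]
      tendsto_mult_left[OF assms(2)[unfolded has_normal_deriv_def], of b]]
  show ?thesis unfolding has_normal_deriv_def
    by (rule Lim_transform_eventually[OF l]) (simp add: algebra_simps)
qed

lemma has_tangential_deriv_lincomb:
  assumes "has_tangential_deriv q u s" "has_tangential_deriv q v t"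
  shows "has_tangential_deriv q (\<lambda>x. a * u x + b * v x) (a * s + b * t)"
proof -
  note l = tendsto_add[OF tendsto_mult_left[OF assms(1)[unfolded has_tangential_deriv_def], of a]
      tendsto_mult_left[OF assms(2)[unfolded has_tangential_deriv_def], of b]]
  show ?thesis unfolding has_tangential_deriv_def
    by (rule Lim_transform_eventually[OF l]) (simp add: algebra_simps)
qed

section \<open>Reflection in the perpendicular bisector of \<open>q 1\<close> and
  \<open>q 2\<close>\<close>

definition mirror :: "real^2 \<Rightarrow> real^2" where
  "mirror x = x - (2 * ((x - (1/2) *\<^sub>R (q 1 + q 2)) \<bullet> (q 1 - q 2)) / ((q 1 - q 2) \<bullet> (q 1 - q 2))) *\<^sub>R (q 1 - q 2)"

text \<open>Negation modulo 3 fixes 0 and swaps 1 and 2, so it encodes the action of the reflection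
  on corners and, letter by letter, on words.\<close>

lemma mirror_q: "mirror (q i) = q (- i)"
proof -
  have "(1::3) \<noteq> 2" "(0::3) \<noteq> 1" "(0::3) \<noteq> 2" by simp_all
  then have n: "(q 1 - q 2) \<bullet> (q 1 - q 2) \<noteq> 0" and d: "dist (q 0) (q 1) = dist (q 0) (q 2)"
    using equi unfolding equilateral_def by (simp, metis)
  have "(q 0 - q 1) \<bullet> (q 0 - q 1) = (q 0 - q 2) \<bullet> (q 0 - q 2)"
    using d by (simp add: dist_norm norm_eq_sqrt_inner)
  then have z: "(q 0 - (1/2) *\<^sub>R (q 1 + q 2)) \<bullet> (q 1 - q 2) = 0"
    by (simp add: inner_diff_left inner_diff_right inner_add_left inner_add_right inner_commute field_simps)
  have h1: "q 1 - (1/2) *\<^sub>R (q 1 + q 2) = (1/2) *\<^sub>R (q 1 - q 2)"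
    and h2: "q 2 - (1/2) *\<^sub>R (q 1 + q 2) = - (1/2) *\<^sub>R (q 1 - q 2)"
    by (simp_all add: vec_eq_iff field_simps)
  have m: "(- 1::3) = 2" "(- 2::3) = 1" by simp_all
  have "\<forall>i. mirror (q i) = q (- i)" unfolding forall_3_eq m
    using n by (simp add: mirror_def z h1 h2 del: scaleR_minus_left)
  then show ?thesis by blast
qed

lemma mirror_mirror [simp]: "mirror (mirror x) = x"
proof -
  let ?n = "q 1 - q 2" and ?c = "(1/2) *\<^sub>R (q 1 + q 2)"
  let ?a = "2 * ((x - ?c) \<bullet> ?n) / (?n \<bullet> ?n)"
  have "(1::3) \<noteq> 2" by simp
  then have n: "?n \<bullet> ?n \<noteq> 0" by simp
  have "(mirror x - ?c) \<bullet> ?n = (x - ?c) \<bullet> ?n - ?a * (?n \<bullet> ?n)"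
    unfolding mirror_def by (simp only: inner_diff_left inner_scaleR_left)
  also have "\<dots> = - ((x - ?c) \<bullet> ?n)" using n by simp
  finally have "2 * ((mirror x - ?c) \<bullet> ?n) / (?n \<bullet> ?n) = - ?a" by simp
  then have "mirror (mirror x) = mirror x + ?a *\<^sub>R ?n" by (subst mirror_def) simp
  then show ?thesis by (simp add: mirror_def)
qed

lemma mirror_sgmap: "mirror (sgmap q i x) = sgmap q (- i) (mirror x)"
proof -
  let ?n = "q 1 - q 2" and ?c = "(1/2) *\<^sub>R (q 1 + q 2)"
  define a where "a y = 2 * ((y - ?c) \<bullet> ?n) / (?n \<bullet> ?n)" for y
  have r: "mirror y = y - a y *\<^sub>R ?n" for y by (simp add: mirror_def a_def)
  have s: "sgmap q j y = (1/2) *\<^sub>R (y + q j)" for j y by (simp add: sgmap_def vec_eq_iff field_simps)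
  have "(1/2) *\<^sub>R (x + y) - ?c = (1/2) *\<^sub>R ((x - ?c) + (y - ?c))" for y
    by (simp add: vec_eq_iff field_simps)
  then have "a ((1/2) *\<^sub>R (x + y)) = (a x + a y) / 2" for y
    unfolding a_def by (simp only: inner_scaleR_left inner_add_left) (simp add: add_divide_distrib)
  then have "mirror (sgmap q i x) = (1/2) *\<^sub>R (x + q i) - ((a x + a (q i)) / 2) *\<^sub>R ?n"
    unfolding s by (simp only: r)
  also have "\<dots> = (1/2) *\<^sub>R (mirror x + mirror (q i))"
    by (simp add: r vec_eq_iff field_simps)
  finally have "mirror (sgmap q i x) = (1/2) *\<^sub>R (mirror x + mirror (q i))" .
  then show ?thesis by (simp add: s mirror_q)
qed

lemma mirror_word: "mirror (sgmap_word q w x) = sgmap_word q (map uminus w) (mirror x)"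
  by (induction w) (auto simp: mirror_sgmap)

lemma mirror_vtx: "mirror (vtx w i) = vtx (map uminus w) (- i)"
  by (simp add: mirror_word mirror_q)

lemma continuous_on_mirror: "continuous_on S mirror"
  unfolding mirror_def by (intro continuous_intros) auto

lemma mirror_vertices:
  assumes "x \<in> vertices q m" shows "mirror x \<in> vertices q m"
proof -
  obtain w i where "length w = m" "x = vtx w i" using assms unfolding vertices_eq by auto
  then show ?thesis using vtx_in_vertices[of "map uminus w" m "- i"] by (simp add: mirror_vtx)
qed

lemma mirror_interior: "x \<in> vertices q m - vertices q 0 \<Longrightarrow> mirror x \<in> vertices q m - vertices q 0"
  by (metis DiffD1 DiffD2 DiffI mirror_mirror mirror_vertices)

text \<open>The vertices are invariant by their explicit description and dense in \<open>SG\<close>,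
  so continuity extends the invariance to \<open>SG\<close>.\<close>

lemma mirror_SG: "x \<in> SG \<Longrightarrow> mirror x \<in> SG"
proof -
  let ?D = "\<Union>m. vertices q m - vertices q 0"
  have "mirror ` ?D \<subseteq> SG" using mirror_interior vertices_subset_SG by blast
  then have "mirror ` closure ?D \<subseteq> SG"
    by (intro image_closure_subset continuous_on_mirror compact_imp_closed compact_SG)
  then show "x \<in> SG \<Longrightarrow> mirror x \<in> SG" unfolding closure_vertices by blast
qed

lemma sum_uminus_3: "(\<Sum>j\<in>UNIV. h (- j :: 3)) = (\<Sum>j\<in>UNIV. h j :: real)"
proof -
  have m: "(- 1::3) = 2" "(- 2::3) = 1" by simp_all
  show ?thesis unfolding sum_UNIV_3 m by simp
qed

lemma inc_mirror: "inc m (mirror x) = (\<lambda>(w, i). (map uminus w, - i)) ` inc m x"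
proof -
  have sub: "(\<lambda>(w, i). (map uminus w, - i)) ` inc m y \<subseteq> inc m (mirror y)" for y
    by (auto simp: inc_def mirror_vtx)
  show ?thesis
  proof (rule antisym[OF _ sub], rule subsetI)
    fix z assume z: "z \<in> inc m (mirror x)"
    let ?f = "\<lambda>(w, i). (map uminus w, - i :: 3)"
    have "?f z \<in> inc m x" using sub[of "mirror x"] z by force
    moreover have "z = ?f (?f z)" by (simp add: case_prod_beta o_def)
    ultimately show "z \<in> ?f ` inc m x" by blast
  qed
qed

lemma vsum_mirror: "vsum m (\<lambda>y. u (mirror y)) x = vsum m u (mirror x)"
proof -
  have "inj_on (\<lambda>(w, i). (map uminus w, - i :: 3)) (inc m x)"
    by (rule inj_on_inverseI[where g="\<lambda>(w, i). (map uminus w, - i)"]) (auto simp: o_def)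
  then have "vsum m u (mirror x) = (\<Sum>(w, i)\<in>inc m x. \<Sum>j\<in>UNIV. u (vtx (map uminus w) j) - u (mirror x))"
    unfolding vsum_def inc_mirror by (subst sum.reindex) (auto simp: case_prod_beta)
  also have "\<dots> = (\<Sum>(w, i)\<in>inc m x. \<Sum>j\<in>UNIV. u (vtx (map uminus w) (- j)) - u (mirror x))"
    by (simp only: sum_uminus_3[where h = "\<lambda>j. u (vtx _ j) - u (mirror x)"])
  finally show ?thesis by (simp add: vsum_def mirror_vtx)
qed

lemma has_laplacian_mirror:
  assumes "has_laplacian q SG u f"
  shows "has_laplacian q SG (\<lambda>x. u (mirror x)) (\<lambda>x. f (mirror x))"
proof -
  have c: "continuous_on SG (\<lambda>x. h (mirror x))" if "continuous_on SG h" for h :: "real^2 \<Rightarrow> real"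
    by (rule continuous_on_compose2[OF that continuous_on_mirror]) (use mirror_SG in blast)
  have "graph_laplacian q SG m (\<lambda>x. u (mirror x)) x = graph_laplacian q SG m u (mirror x)"
    if "x \<in> vertices q m - vertices q 0" for m x
  proof -
    have x: "x \<in> vertices q m" using that by blast
    show ?thesis unfolding graph_laplacian_eq[OF x] graph_laplacian_eq[OF mirror_vertices[OF x]] vsum_mirror ..
  qed
  then show ?thesis using assms c mirror_interior unfolding has_laplacian_def
    by (metis (no_types, lifting))
qed

lemma has_laplacian_pow_mirror:
  "has_laplacian_pow q SG n u f \<Longrightarrow> has_laplacian_pow q SG n (\<lambda>x. u (mirror x)) (\<lambda>x. f (mirror x))"
proof (induction n arbitrary: f)
  case (Suc n)
  then obtain g where "has_laplacian_pow q SG n u g" "has_laplacian q SG g f" by auto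
  then show ?case using Suc.IH has_laplacian_mirror unfolding has_laplacian_pow.simps(2) by blast
qed (simp add: mirror_SG)

lemma mirror_corner: "mirror ((sgmap q 0 ^^ m) x) = (sgmap q 0 ^^ m) (mirror x)"
  by (induction m) (auto simp: mirror_sgmap)

lemma mirror_q012 [simp]: "mirror (q 0) = q 0" "mirror (q 1) = q 2" "mirror (q 2) = q 1"
proof -
  have m: "(- 1::3) = 2" "(- 2::3) = 1" by simp_all
  show "mirror (q 0) = q 0" "mirror (q 1) = q 2" "mirror (q 2) = q 1" unfolding mirror_q m by simp_all
qed

text \<open>The reflection swaps the two sequences of points tending to \<open>q 0\<close>. The
  normal difference is symmetric in them; the tangential one below changes sign.\<close>

lemma has_normal_deriv_mirror: "has_normal_deriv q u a \<Longrightarrow> has_normal_deriv q (\<lambda>x. u (mirror x)) a"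
  unfolding has_normal_deriv_def by (simp add: mirror_corner algebra_simps)

lemma has_tangential_deriv_mirror: 
  assumes "has_tangential_deriv q u a" shows "has_tangential_deriv q (\<lambda>x. u (mirror x)) (- a)"
  using tendsto_minus[OF assms[unfolded has_tangential_deriv_def]]
  unfolding has_tangential_deriv_def by (simp add: mirror_corner algebra_simps)

text \<open>By the 1/5-2/5 rule the sum and the difference of the values at the two points nearing
  \<open>q 0\<close> shrink by 3/5 and 1/5 per step. The rescaled sequences in the derivatives are
  therefore constant, and their limits can be read off at level 0.\<close>

lemma harmonic_jet:
  assumes "has_laplacian q SG u (\<lambda>x. 0)" "u (q 0) = 0" "has_normal_deriv q u 0" "has_tangential_deriv q u t"
  shows "u (q 1) = t / 2" "u (q 2) = - t / 2"
proof -
  define a where "a m = u ((sgmap q 0 ^^ m) (q 1))" for m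
  define b where "b m = u ((sgmap q 0 ^^ m) (q 2))" for m
  have rec: "5 * a (Suc m) = 2 * a m + b m" "5 * b (Suc m) = 2 * b m + a m" for m
  proof -
    have r: "replicate m (0::3) @ [0] = replicate (Suc m) 0" by (simp add: replicate_append_same)
    have f: "(sgmap q 0 ^^ m) (q 0) = q 0" by (induction m) auto
    note h = harmonic_midpoint[of m u "replicate m 0", OF harmonic_exact[OF assms(1)]]
    show "5 * a (Suc m) = 2 * a m + b m" "5 * b (Suc m) = 2 * b m + a m"
      using h assms(2) unfolding r sgmap_word_replicate f by (simp_all add: a_def b_def)
  qed
  have "(5/3) ^ m * (a m + b m) = a 0 + b 0" for m
  proof (induction m)
    case (Suc m)
    have "a (Suc m) + b (Suc m) = 3/5 * (a m + b m)" using rec[of m] by simp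
    then have "(5/3) ^ Suc m * (a (Suc m) + b (Suc m)) = (5/3) ^ m * (a m + b m)" by simp
    then show ?case using Suc by simp
  qed simp
  then have "(5/3) ^ m * (2 * u (q 0) - u ((sgmap q 0 ^^ m) (q 1)) - u ((sgmap q 0 ^^ m) (q 2))) = - (a 0 + b 0)" for m
    using assms(2) by (simp add: a_def b_def algebra_simps)
  then have s: "a 0 + b 0 = 0" using assms(3) LIMSEQ_unique[OF tendsto_const] unfolding has_normal_deriv_def by force
  have "5 ^ m * (a m - b m) = a 0 - b 0" for m
  proof (induction m)
    case (Suc m)
    have "a (Suc m) - b (Suc m) = 1/5 * (a m - b m)" using rec[of m] by simp
    then have "5 ^ Suc m * (a (Suc m) - b (Suc m)) = 5 ^ m * (a m - b m)" by simp
    then show ?case using Suc by simp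
  qed simp
  then have "a 0 - b 0 = t" using assms(4) LIMSEQ_unique[OF tendsto_const] unfolding has_tangential_deriv_def a_def b_def by force
  then show "u (q 1) = t / 2" "u (q 2) = - t / 2" using s by (simp_all add: a_def b_def)
qed

end

section \<open>Antisymmetric monomials\<close>

locale gasket_green = gasket +
  fixes \<mu> :: "(real^2) measure" and G :: "real^2 \<Rightarrow> real^2 \<Rightarrow> real"
  assumes gasket_measure: "is_gasket_measure q SG \<mu>" and green: "is_green_function q SG \<mu> G"
begin

lemma green_iff:
  assumes "continuous_on SG f"
  shows "has_laplacian q SG u (\<lambda>x. - f x) \<and> (\<forall>v\<in>vertices q 0. u v = 0) \<longleftrightarrow>
    (\<forall>x\<in>SG. u x = (LINT y|\<mu>. G x y * f y))"
  using green assms unfolding is_green_function_def by blast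

text \<open>Obtained from the equivalence in \<open>is_green_function\<close> with zero right-hand
  side.\<close>

lemma dirichlet_unique:
  assumes "has_laplacian q SG u (\<lambda>x. 0)" "u (q 0) = 0" "u (q 1) = 0" "u (q 2) = 0" "x \<in> SG"
  shows "u x = 0"
proof -
  have "\<forall>i. u (q i) = 0" unfolding forall_3_eq using assms by blast
  then show ?thesis using green_iff[of "\<lambda>x. 0" u] assms by auto
qed

text \<open>The conditions on an antisymmetric monomial with all data set to zero, as met by the
  difference of two functions with the same data.\<close>

definition jet_null :: "nat \<Rightarrow> (real^2 \<Rightarrow> real) \<Rightarrow> bool" where
  "jet_null j u \<longleftrightarrow> has_laplacian_pow q SG (Suc j) u (\<lambda>x. 0) \<and>
     (\<forall>m\<le>j. \<exists>g. has_laplacian_pow q SG m u g \<and> g (q 0) = 0 \<and> has_normal_deriv q g 0 \<and> has_tangential_deriv q g 0)"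

text \<open>The highest remaining power of the Laplacian is harmonic with zero jet. It vanishes at
  the corners by \<open>harmonic_jet\<close>, hence on \<open>SG\<close>, and the degree drops by
  one.\<close>

lemma jet_null_vanish: "jet_null j u \<Longrightarrow> x \<in> SG \<Longrightarrow> u x = 0"
proof (induction j arbitrary: x)
  case (0 x)
  obtain g where g: "has_laplacian_pow q SG 0 u g" "g (q 0) = 0" "has_normal_deriv q g 0" "has_tangential_deriv q g 0"
    using 0 unfolding jet_null_def by blast
  obtain g' where "has_laplacian_pow q SG 0 u g'" "has_laplacian q SG g' (\<lambda>x. 0)"
    using 0 unfolding jet_null_def by auto
  then have "has_laplacian q SG g (\<lambda>x. 0)" using g by (auto intro: has_laplacian_cong)
  from dirichlet_unique[OF this g(2) _ _ 0(2)] harmonic_jet[OF this g(2-4)] have "g x = 0" by simp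
  then show ?case using g(1) 0(2) by simp
next
  case (Suc j x)
  obtain g where g: "has_laplacian_pow q SG (Suc j) u g" "g (q 0) = 0" "has_normal_deriv q g 0" "has_tangential_deriv q g 0"
    using Suc.prems unfolding jet_null_def by blast
  obtain g' where g': "has_laplacian_pow q SG (Suc j) u g'" "has_laplacian q SG g' (\<lambda>x. 0)"
    using Suc.prems unfolding jet_null_def by (metis has_laplacian_pow.simps(2))
  have "has_laplacian q SG g (\<lambda>x. 0)" using has_laplacian_cong[OF g'(2) has_laplacian_pow_unique[OF g'(1) g(1)]] by simp
  from dirichlet_unique[OF this g(2)] harmonic_jet[OF this g(2-4)] have "g y = 0" if "y \<in> SG" for y
    using that by simp
  then have z: "has_laplacian_pow q SG (Suc j) u (\<lambda>x. 0)" using has_laplacian_pow_cong[OF g(1), of u "\<lambda>x. 0"] by simp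
  have "jet_null j u" unfolding jet_null_def
  proof (intro conjI z allI impI)
    fix m assume "m \<le> j"
    then have "m \<le> Suc j" by simp
    then show "\<exists>g. has_laplacian_pow q SG m u g \<and> g (q 0) = 0 \<and> has_normal_deriv q g 0 \<and> has_tangential_deriv q g 0"
      using Suc.prems(1) unfolding jet_null_def by blast
  qed
  then show ?case using Suc.IH Suc.prems(2) by blast
qed

lemma antisym_monomial_q0:
  assumes "is_antisym_monomial q SG j P"
  shows "P (q 0) = 0"
proof -
  obtain g where "has_laplacian_pow q SG 0 P g" "g (q 0) = 0"
    using assms unfolding is_antisym_monomial_def by blast
  then show ?thesis using q_in_SG[of 0] by simp
qed

text \<open>In \<open>P\<close> plus its reflection the tangential derivatives cancel, while the
  values and normal derivatives at \<open>q 0\<close> were zero already, so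
  \<open>jet_null_vanish\<close> applies.\<close>

lemma antisym_monomial_antisym:
  assumes P: "is_antisym_monomial q SG j P" and x: "x \<in> SG"
  shows "P (mirror x) = - P x"
proof -
  let ?U = "\<lambda>x. 1 * P x + 1 * P (mirror x)"
  have "jet_null j ?U" unfolding jet_null_def
  proof (intro conjI allI impI)
    have "has_laplacian_pow q SG (Suc j) P (\<lambda>x. 0)" using P by (simp add: is_antisym_monomial_def)
    from has_laplacian_pow_lincomb[OF this has_laplacian_pow_mirror[OF this], of 1 1]
    show "has_laplacian_pow q SG (Suc j) ?U (\<lambda>x. 0)" by simp
    fix m assume "m \<le> j"
    then obtain g where g: "has_laplacian_pow q SG m P g" "g (q 0) = 0" "has_normal_deriv q g 0"
      "has_tangential_deriv q g (if m = j then 1 else 0)"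
      using P unfolding is_antisym_monomial_def by blast
    let ?g = "\<lambda>x. 1 * g x + 1 * g (mirror x)"
    have "has_laplacian_pow q SG m ?U ?g" using has_laplacian_pow_lincomb[OF g(1) has_laplacian_pow_mirror[OF g(1)]] by blast
    moreover have "has_normal_deriv q ?g 0"
      using has_normal_deriv_lincomb[OF g(3) has_normal_deriv_mirror[OF g(3)], of 1 1] by simp
    moreover have "has_tangential_deriv q ?g 0"
      using has_tangential_deriv_lincomb[OF g(4) has_tangential_deriv_mirror[OF g(4)], of 1 1] by simp
    moreover have "?g (q 0) = 0" using g(2) by simp
    ultimately show "\<exists>g. has_laplacian_pow q SG m ?U g \<and> g (q 0) = 0 \<and> has_normal_deriv q g 0 \<and> has_tangential_deriv q g 0" by blast
  qed
  from jet_null_vanish[OF this x] show ?thesis by simp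
qed

text \<open>The Laplacian shifts the jet of \<open>P\<close> by one place, which gives the jet of
  \<open>Q\<close>; so their difference is \<open>jet_null\<close>.\<close>

lemma antisym_monomial_laplacian:
  assumes P: "is_antisym_monomial q SG (Suc j) P" and Q: "is_antisym_monomial q SG j Q"
  shows "has_laplacian q SG P Q"
proof -
  have "has_laplacian_pow q SG (Suc (Suc j)) P (\<lambda>x. 0)" using P unfolding is_antisym_monomial_def by blast
  then obtain h where h: "has_laplacian q SG P h" "has_laplacian_pow q SG (Suc j) h (\<lambda>x. 0)"
    unfolding has_laplacian_pow_Suc_left[of "Suc j"] by blast
  let ?U = "\<lambda>x. 1 * h x + (- 1) * Q x"
  have "jet_null j ?U" unfolding jet_null_def
  proof (intro conjI allI impI)
    have "has_laplacian_pow q SG (Suc j) Q (\<lambda>x. 0)" using Q by (simp add: is_antisym_monomial_def)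
    from has_laplacian_pow_lincomb[OF h(2) this, of 1 "- 1"]
    show "has_laplacian_pow q SG (Suc j) ?U (\<lambda>x. 0)" by simp
    fix m assume m: "m \<le> j"
    then obtain g where g: "has_laplacian_pow q SG m Q g" "g (q 0) = 0" "has_normal_deriv q g 0"
      "has_tangential_deriv q g (if m = j then 1 else 0)"
      using Q unfolding is_antisym_monomial_def by blast
    from m have "Suc m \<le> Suc j" by simp
    then obtain f where f: "has_laplacian_pow q SG (Suc m) P f" "f (q 0) = 0" "has_normal_deriv q f 0"
      "has_tangential_deriv q f (if Suc m = Suc j then 1 else 0)"
      using P unfolding is_antisym_monomial_def by blast
    obtain h' where h': "has_laplacian q SG P h'" "has_laplacian_pow q SG m h' f"
      using f(1) unfolding has_laplacian_pow_Suc_left by blast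
    have "has_laplacian_pow q SG m h f" using has_laplacian_pow_cong[OF h'(2)] has_laplacian_unique[OF h'(1) h(1)] by blast
    let ?g = "\<lambda>x. 1 * f x + (- 1) * g x"
    have "has_laplacian_pow q SG m ?U ?g" using has_laplacian_pow_lincomb[OF \<open>has_laplacian_pow q SG m h f\<close> g(1)] by blast
    moreover have "has_normal_deriv q ?g 0"
      using has_normal_deriv_lincomb[OF f(3) g(3), of 1 "- 1"] by simp
    moreover have "has_tangential_deriv q ?g 0"
      using has_tangential_deriv_lincomb[OF f(4) g(4), of 1 "- 1"] by simp
    moreover have "?g (q 0) = 0" using f(2) g(2) by simp
    ultimately show "\<exists>g. has_laplacian_pow q SG m ?U g \<and> g (q 0) = 0 \<and> has_normal_deriv q g 0 \<and> has_tangential_deriv q g 0" by blast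
  qed
  then have "h x = Q x" if "x \<in> SG" for x using jet_null_vanish[OF _ that] by fastforce
  then show ?thesis using has_laplacian_cong[OF h(1)] by blast
qed

lemma antisym_monomial_0:
  assumes "is_antisym_monomial q SG 0 P"
  shows "has_laplacian q SG P (\<lambda>x. 0)" "P (q 1) = 1 / 2" "P (q 2) = - 1 / 2"
proof -
  obtain g where g: "\<forall>x\<in>SG. g x = P x" "has_laplacian q SG g (\<lambda>x. 0)"
    using assms unfolding is_antisym_monomial_def by auto
  then show l: "has_laplacian q SG P (\<lambda>x. 0)" using has_laplacian_cong[OF g(2)] by simp
  obtain h where h: "\<forall>x\<in>SG. h x = P x" "h (q 0) = 0" "has_normal_deriv q h 0" "has_tangential_deriv q h 1"
    using assms unfolding is_antisym_monomial_def by auto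
  have "has_laplacian q SG h (\<lambda>x. 0)" using has_laplacian_cong[OF l] h(1) by simp
  from harmonic_jet[OF this h(2-4)] show "P (q 1) = 1 / 2" "P (q 2) = - 1 / 2"
    using h(1) q_in_SG[of 1] q_in_SG[of 2] by simp_all
qed

lemma antisym_monomial_continuous:
  assumes "is_antisym_monomial q SG j P"
  shows "continuous_on SG P"
  using assms unfolding is_antisym_monomial_def has_laplacian_pow_Suc_left has_laplacian_def by blast

text \<open>The k-th power of the Laplacian annihilates all lower monomials and sends
  \<open>P k\<close> to a function with tangential derivative 1. This makes every Gram-Schmidt
  polynomial nonzero.\<close>

lemma antisym_monomials_independent:
  assumes P: "\<And>l. is_antisym_monomial q SG l (P l)"
  shows "\<exists>x\<in>SG. P k x + (\<Sum>l<k. a l * P l x) \<noteq> 0"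
proof (rule ccontr)
  assume "\<not> (\<exists>x\<in>SG. P k x + (\<Sum>l<k. a l * P l x) \<noteq> 0)"
  then have z: "P k x + (\<Sum>l<k. a l * P l x) = 0" if "x \<in> SG" for x using that by blast
  have "has_laplacian_pow q SG k (P l) (\<lambda>x. 0)" if "l < k" for l
    using has_laplacian_pow_vanish_mono[of "Suc l" "P l" k] P[of l] that unfolding is_antisym_monomial_def by simp
  from has_laplacian_pow_sum[of k, OF this, where c = a]
  have s: "has_laplacian_pow q SG k (\<lambda>x. \<Sum>l<k. a l * P l x) (\<lambda>x. 0)" by simp
  obtain g where g: "has_laplacian_pow q SG k (P k) g" "has_tangential_deriv q g 1"
    using P[of k] unfolding is_antisym_monomial_def by auto
  have "has_laplacian_pow q SG k (\<lambda>x. P k x + (\<Sum>l<k. a l * P l x)) g"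
    using has_laplacian_pow_lincomb[OF g(1) s, of 1 1] by simp
  then have "has_laplacian_pow q SG k (\<lambda>x. 0) g" using has_laplacian_pow_cong[of k _ g "\<lambda>x. 0" g] z by blast
  then have "g x = 0" if "x \<in> SG" for x using has_laplacian_pow_unique[OF _ has_laplacian_pow_zero that] by blast
  then have "has_tangential_deriv q (\<lambda>x. 0) 1" by (rule has_tangential_deriv_cong[OF g(2)])
  then show False unfolding has_tangential_deriv_def using LIMSEQ_unique[OF tendsto_const] by force
qed

text \<open>\<open>\<Delta>\<close> lowers the degree of a monomial by one, so the difference below is harmonic; it is
  antisymmetric on the boundary, hence a multiple of \<open>P 0\<close>.\<close>

lemma green_antisym_span:
  assumes P: "\<And>l. is_antisym_monomial q SG l (P l)"
    and u: "has_laplacian q SG u (\<lambda>x. P k x + (\<Sum>l<k. a l * P l x))" "\<And>i. u (q i) = 0"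
  shows "\<exists>t. \<forall>x\<in>SG. u x = P (Suc k) x + (\<Sum>l<k. a l * P (Suc l) x) + t * P 0 x"
proof -
  let ?v = "\<lambda>x. P (Suc k) x + (\<Sum>l<k. a l * P (Suc l) x)"
  have L: "has_laplacian q SG (P (Suc l)) (P l)" for l using antisym_monomial_laplacian P by blast
  have p1: "has_laplacian_pow q SG (Suc 0) w g \<longleftrightarrow> has_laplacian q SG w g" for w g
    using has_laplacian_cong[of w _ w g] unfolding has_laplacian_pow_Suc_left by auto
  have "has_laplacian q SG ?v (\<lambda>x. P k x + (\<Sum>l<k. a l * P l x))"
    using has_laplacian_lincomb[OF L[of k] has_laplacian_pow_sum[of k "Suc 0" "\<lambda>l. P (Suc l)" P a, unfolded p1, OF L], of 1 1] by simp
  from has_laplacian_lincomb[OF u(1) this, of 1 "- 1"]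
  have h: "has_laplacian q SG (\<lambda>x. u x - ?v x) (\<lambda>x. 0)"
    by (simp only: mult_1 mult_minus1 add_uminus_conv_diff diff_self)
  \<comment> \<open>Chosen to make the difference vanish at \<open>q 1\<close>, where
    \<open>u\<close> is 0 and \<open>P 0\<close> is 1/2. Antisymmetry then settles
    \<open>q 2\<close>.\<close>
  define t where "t = - 2 * ?v (q 1)"
  have v0: "?v (q 0) = 0" using antisym_monomial_q0[OF P] by simp
  have "P l (q 2) = - P l (q 1)" for l using antisym_monomial_antisym[OF P q_in_SG, of l 1] by simp
  then have v2: "?v (q 2) = - ?v (q 1)" by (simp add: sum_negf)
  have w: "has_laplacian q SG (\<lambda>x. u x - ?v x - t * P 0 x) (\<lambda>x. 0)"
    using has_laplacian_lincomb[OF h antisym_monomial_0(1)[OF P], of 1 "- t"] by simp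
  note b = antisym_monomial_0(2,3)[OF P]
  have "u (q 0) - ?v (q 0) - t * P 0 (q 0) = 0" unfolding v0 u(2) antisym_monomial_q0[OF P] by simp
  moreover have "u (q 1) - ?v (q 1) - t * P 0 (q 1) = 0" unfolding u(2) b t_def by simp
  moreover have "u (q 2) - ?v (q 2) - t * P 0 (q 2) = 0" unfolding u(2) v2 b t_def by (simp add: field_simps)
  ultimately have "u x - ?v x - t * P 0 x = 0" if "x \<in> SG" for x
    using dirichlet_unique[OF w _ _ _ that] by blast
  then have "\<forall>x\<in>SG. u x = ?v x + t * P 0 x" by (simp add: algebra_simps)
  then show ?thesis by blast
qed

end

section \<open>Energy\<close>

context gasket_green begin

section \<open>Integration on the gasket\<close>

lemma space_mu: "space \<mu> = SG"
  using gasket_measure sets_eq_imp_space_eq[of \<mu> "restrict_space borel SG"]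
  by (simp add: is_gasket_measure_def space_restrict_space)

lemma emeasure_SG: "emeasure \<mu> (space \<mu>) = 1"
  using gasket_measure by (simp add: is_gasket_measure_def space_mu)

sublocale finite_measure \<mu>
  by (rule finite_measureI) (simp add: emeasure_SG)

lemma measure_SG: "measure \<mu> SG = 1"
  using emeasure_SG by (simp add: measure_def space_mu)

lemma cell_sets: "sgmap_word q w ` SG \<in> sets \<mu>"
proof -
  have "compact (sgmap_word q w ` SG)"
    using compact_continuous_image[OF continuous_on_sgmap_word compact_SG] .
  then have "sgmap_word q w ` SG \<in> sets borel" by (intro borel_closed compact_imp_closed)
  moreover have "sgmap_word q w ` SG \<subseteq> SG" using sgmap_word_in_SG by blast
  moreover have "SG \<in> sets borel" using compact_SG by (intro borel_closed compact_imp_closed)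
  ultimately show ?thesis using gasket_measure
    by (auto simp: is_gasket_measure_def sets_restrict_space_iff)
qed

lemma measure_cell: "measure \<mu> (sgmap_word q w ` SG) = (1/3) ^ length w"
  using gasket_measure by (simp add: is_gasket_measure_def measure_def)

lemma continuous_bounded:
  assumes "continuous_on SG (f :: _ \<Rightarrow> real)"
  obtains B where "B \<ge> 0" "\<And>x. x \<in> SG \<Longrightarrow> \<bar>f x\<bar> \<le> B"
proof -
  have "bounded (f ` SG)" using compact_imp_bounded compact_continuous_image assms compact_SG by blast
  then obtain B where "\<forall>x\<in>SG. \<bar>f x\<bar> \<le> B" by (auto simp: bounded_iff)
  moreover then have "B \<ge> 0" using SG_ne by force
  ultimately show ?thesis using that by blast
qed

lemma continuous_measurable:
  assumes "continuous_on SG (f :: _ \<Rightarrow> real)"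
  shows "f \<in> borel_measurable \<mu>"
proof -
  have "sets \<mu> = sets (restrict_space borel SG)" using gasket_measure by (simp add: is_gasket_measure_def)
  then show ?thesis using borel_measurable_continuous_on_restrict[OF assms] measurable_cong_sets by blast
qed

lemma continuous_integrable:
  assumes "continuous_on SG (f :: _ \<Rightarrow> real)"
  shows "integrable \<mu> f"
proof -
  obtain B where "\<And>x. x \<in> SG \<Longrightarrow> \<bar>f x\<bar> \<le> B" using continuous_bounded[OF assms] by blast
  then have "AE x in \<mu>. norm (f x) \<le> B" by (intro AE_I2) (simp add: space_mu)
  then show ?thesis by (rule integrable_const_bound) (rule continuous_measurable[OF assms])
qed

text \<open>The cells of level \<open>m\<close> cover \<open>SG\<close> and their masses add up to 1, so their overlaps are null.\<close>

lemma cells_disjoint_AE: "AE x in \<mu>. (\<Sum>w\<in>words m. indicator (sgmap_word q w ` SG) x) = (1::real)"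
proof -
  let ?h = "\<lambda>x. (\<Sum>w\<in>words m. indicator (sgmap_word q w ` SG) x) - (1::real)"
  have i: "integrable \<mu> (indicator (sgmap_word q w ` SG) :: _ \<Rightarrow> real)" for w
    using cell_sets by (intro integrable_real_indicator) (auto simp: emeasure_eq_measure)
  then have "integrable \<mu> ?h" by simp
  moreover have "?h x \<ge> 0" if x: "x \<in> space \<mu>" for x
  proof -
    obtain w where "w \<in> words m" "x \<in> sgmap_word q w ` SG" using x SG_words[of m] unfolding space_mu by blast
    then show ?thesis
      using member_le_sum[of w "words m" "\<lambda>w. indicator (sgmap_word q w ` SG) x :: real"] by simp
  qed
  moreover have "(\<integral>x. ?h x \<partial>\<mu>) = 0"
  proof -
    have "(\<integral>x. ?h x \<partial>\<mu>) = (\<Sum>w\<in>words m. measure \<mu> (sgmap_word q w ` SG)) - 1"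
    proof -
      have "sgmap_word q w ` SG \<inter> SG = sgmap_word q w ` SG" for w using sgmap_word_in_SG by blast
      then show ?thesis using i measure_SG by (simp add: Bochner_Integration.integral_sum space_mu)
    qed
    also have "\<dots> = 0" by (simp add: measure_cell card_words power_divide)
    finally show ?thesis .
  qed
  ultimately have "AE x in \<mu>. ?h x = 0"
    using integral_nonneg_eq_0_iff_AE[of \<mu> ?h] by (simp add: AE_I2)
  then show ?thesis by simp
qed

lemma integral_cells:
  fixes f :: "real^2 \<Rightarrow> real"
  assumes "continuous_on SG f"
  shows "(\<integral>x. f x \<partial>\<mu>) = (\<Sum>w\<in>words m. \<integral>x. f x * indicator (sgmap_word q w ` SG) x \<partial>\<mu>)"
proof -
  note fi = continuous_integrable[OF assms]
  have fm [measurable]: "f \<in> borel_measurable \<mu>" using fi by simp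
  have cm [measurable]: "sgmap_word q w ` SG \<in> sets \<mu>" for w by (rule cell_sets)
  have "(\<integral>x. f x \<partial>\<mu>) = (\<integral>x. (\<Sum>w\<in>words m. f x * indicator (sgmap_word q w ` SG) x) \<partial>\<mu>)"
  proof (rule integral_cong_AE)
    show "AE x in \<mu>. f x = (\<Sum>w\<in>words m. f x * indicator (sgmap_word q w ` SG) x)"
      using cells_disjoint_AE[of m] by eventually_elim (simp flip: sum_distrib_left)
  qed measurable
  also have "\<dots> = (\<Sum>w\<in>words m. \<integral>x. f x * indicator (sgmap_word q w ` SG) x \<partial>\<mu>)"
    by (intro Bochner_Integration.integral_sum integrable_real_mult_indicator cell_sets fi)
  finally show ?thesis .
qed

lemma cell_integral_bound:
  fixes f :: "real^2 \<Rightarrow> real"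
  assumes f: "continuous_on SG f" and c: "\<And>x. x \<in> sgmap_word q w ` SG \<Longrightarrow> \<bar>f x - c\<bar> \<le> e"
  shows "\<bar>(\<integral>x. f x * indicator (sgmap_word q w ` SG) x \<partial>\<mu>) - (1/3) ^ length w * c\<bar> \<le> (1/3) ^ length w * e"
proof -
  let ?I = "indicator (sgmap_word q w ` SG) :: _ \<Rightarrow> real"
  have i: "integrable \<mu> (\<lambda>x. f x * ?I x)"
    by (rule integrable_real_mult_indicator[OF cell_sets continuous_integrable[OF f]])
  have k: "integrable \<mu> (\<lambda>x. a * ?I x)" for a
    using cell_sets by (intro integrable_mult_right integrable_real_indicator) (auto simp: emeasure_eq_measure)
  have ki: "(\<integral>x. a * ?I x \<partial>\<mu>) = (1/3) ^ length w * a" for a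
  proof -
    have "sgmap_word q w ` SG \<inter> SG = sgmap_word q w ` SG" using sgmap_word_in_SG by blast
    then show ?thesis by (simp add: measure_cell space_mu)
  qed
  have "(\<integral>x. f x * ?I x \<partial>\<mu>) \<le> (\<integral>x. (c + e) * ?I x \<partial>\<mu>)"
    by (intro integral_mono i k) (use c in \<open>force simp: indicator_def abs_le_iff\<close>)
  moreover have "(\<integral>x. (c - e) * ?I x \<partial>\<mu>) \<le> (\<integral>x. f x * ?I x \<partial>\<mu>)"
    by (intro integral_mono i k) (use c in \<open>force simp: indicator_def abs_le_iff\<close>)
  ultimately show ?thesis unfolding ki by (simp add: abs_le_iff algebra_simps)
qed

text \<open>On a small cell \<open>f\<close> is close to the mean of its three corner values. The
  exponent \<open>Suc m\<close> combines the mass of a cell with the factor 1/3 of this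
  mean.\<close>

lemma riemann_sums:
  fixes f :: "real^2 \<Rightarrow> real"
  assumes f: "continuous_on SG f"
  shows "(\<lambda>m. (1/3) ^ Suc m * (\<Sum>w\<in>words m. \<Sum>i\<in>UNIV. f (vtx w i))) \<longlonglongrightarrow> (\<integral>x. f x \<partial>\<mu>)"
proof (rule LIMSEQ_I)
  fix r :: real assume "r > 0"
  then have r: "r / 2 > 0" by simp
  obtain d where d: "d > 0" "\<And>x y. x \<in> SG \<Longrightarrow> y \<in> SG \<Longrightarrow> dist y x < d \<Longrightarrow> dist (f y) (f x) < r / 2"
    using compact_uniformly_continuous[OF f compact_SG] r unfolding uniformly_continuous_on_def by blast
  obtain M where M: "\<And>m w x y. M \<le> m \<Longrightarrow> length w = m \<Longrightarrow> x \<in> sgmap_word q w ` SG \<Longrightarrow> y \<in> sgmap_word q w ` SG \<Longrightarrow> dist x y < d"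
    using small_cells[OF d(1)] by blast
  have "norm ((1/3) ^ Suc m * (\<Sum>w\<in>words m. \<Sum>i\<in>UNIV. f (vtx w i)) - (\<integral>x. f x \<partial>\<mu>)) < r" if m: "m \<ge> M" for m
  proof -
    define c where "c w = (f (vtx w 0) + f (vtx w 1) + f (vtx w 2)) / 3" for w
    have b: "\<bar>(\<integral>x. f x * indicator (sgmap_word q w ` SG) x \<partial>\<mu>) - (1/3) ^ m * c w\<bar> \<le> (1/3) ^ m * (r/2)"
      if w: "w \<in> words m" for w
    proof -
      have "\<bar>f x - c w\<bar> \<le> r / 2" if x: "x \<in> sgmap_word q w ` SG" for x
      proof -
        have "\<bar>f x - f (vtx w i)\<bar> < r / 2" for i
        proof -
          have "vtx w i \<in> sgmap_word q w ` SG" using q_in_SG by blast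
          then have "dist x (vtx w i) < d" using M[OF m _ x] w by blast
          moreover have "x \<in> SG" "vtx w i \<in> SG" using x sgmap_word_in_SG q_in_SG by auto
          ultimately show ?thesis using d(2)[of "vtx w i" x] by (simp add: dist_real_def)
        qed
        from this[of 0] this[of 1] this[of 2] show ?thesis
          unfolding c_def abs_le_iff abs_less_iff by (elim conjE, intro conjI) (simp_all add: field_simps)
      qed
      from cell_integral_bound[OF f, of w "c w" "r / 2", OF this] show ?thesis using w by simp
    qed
    have "(1/3) ^ Suc m * (\<Sum>w\<in>words m. \<Sum>i\<in>UNIV. f (vtx w i)) = (\<Sum>w\<in>words m. (1/3) ^ m * c w)"
      unfolding sum_UNIV_3 c_def sum_distrib_left by (intro sum.cong) auto
    then have "\<bar>(1/3) ^ Suc m * (\<Sum>w\<in>words m. \<Sum>i\<in>UNIV. f (vtx w i)) - (\<integral>x. f x \<partial>\<mu>)\<bar>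
      = \<bar>\<Sum>w\<in>words m. (\<integral>x. f x * indicator (sgmap_word q w ` SG) x \<partial>\<mu>) - (1/3) ^ m * c w\<bar>"
      unfolding integral_cells[OF f, of m] sum_subtractf by simp
    also have "\<dots> \<le> (\<Sum>w\<in>words m. (1/3) ^ m * (r/2))"
      by (rule order_trans[OF sum_abs], rule sum_mono) (rule b)
    also have "\<dots> = r / 2" by (simp add: card_words power_divide)
    finally show ?thesis using \<open>r > 0\<close> by simp
  qed
  then show "\<exists>no. \<forall>m\<ge>no. norm ((1/3) ^ Suc m * (\<Sum>w\<in>words m. \<Sum>i\<in>UNIV. f (vtx w i)) - (\<integral>x. f x \<partial>\<mu>)) < r" by blast
qed

section \<open>Graph energies and positivity of the Green operator\<close>

definition energy :: "nat \<Rightarrow> (real^2 \<Rightarrow> real) \<Rightarrow> real" where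
  "energy m u = (\<Sum>w\<in>words m. (u (vtx w 0) - u (vtx w 1))\<^sup>2 + (u (vtx w 1) - u (vtx w 2))\<^sup>2 + (u (vtx w 0) - u (vtx w 2))\<^sup>2)"

lemma energy_nonneg: "energy m u \<ge> 0"
  unfolding energy_def by (intro sum_nonneg) auto

text \<open>The minimum of the left-hand side over \<open>a\<close>, \<open>b\<close>, \<open>c\<close> is attained at the harmonic extension of
  \<open>x\<close>, \<open>y\<close>, \<open>z\<close>, which the 1/5--2/5 rule describes; the proof completes squares around it.\<close>

lemma cell_energy_mono:
  fixes x y z a b c :: real
  shows "((x - a)\<^sup>2 + (a - b)\<^sup>2 + (x - b)\<^sup>2) + ((a - y)\<^sup>2 + (y - c)\<^sup>2 + (a - c)\<^sup>2) + ((b - c)\<^sup>2 + (c - z)\<^sup>2 + (b - z)\<^sup>2)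
    \<ge> 3/5 * ((x - y)\<^sup>2 + (y - z)\<^sup>2 + (x - z)\<^sup>2)"
proof -
  define A B C where "A = a - (2*x + 2*y + z)/5" and "B = b - (2*x + 2*z + y)/5" and "C = c - (2*y + 2*z + x)/5"
  have abc: "a = A + (2*x + 2*y + z)/5" "b = B + (2*x + 2*z + y)/5" "c = C + (2*y + 2*z + x)/5"
    by (simp_all add: A_def B_def C_def)
  have "((x - a)\<^sup>2 + (a - b)\<^sup>2 + (x - b)\<^sup>2) + ((a - y)\<^sup>2 + (y - c)\<^sup>2 + (a - c)\<^sup>2) + ((b - c)\<^sup>2 + (c - z)\<^sup>2 + (b - z)\<^sup>2)
    = 3/5 * ((x - y)\<^sup>2 + (y - z)\<^sup>2 + (x - z)\<^sup>2)
      + (2 * A\<^sup>2 + 2 * B\<^sup>2 + 2 * C\<^sup>2 + (A - B)\<^sup>2 + (B - C)\<^sup>2 + (A - C)\<^sup>2)"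
    unfolding abc by (simp add: power2_eq_square field_simps)
  then show ?thesis by (simp add: add_nonneg_nonneg)
qed

lemma energy_mono: "energy m u \<le> 5/3 * energy (Suc m) u"
proof -
  have "3/5 * energy m u \<le> energy (Suc m) u"
    unfolding energy_def sum_words_Suc sum_distrib_left
  proof (rule sum_mono)
    fix w :: "3 list"
    show "3/5 * ((u (vtx w 0) - u (vtx w 1))\<^sup>2 + (u (vtx w 1) - u (vtx w 2))\<^sup>2 + (u (vtx w 0) - u (vtx w 2))\<^sup>2)
      \<le> (\<Sum>i\<in>UNIV. (u (vtx (w @ [i]) 0) - u (vtx (w @ [i]) 1))\<^sup>2 + (u (vtx (w @ [i]) 1) - u (vtx (w @ [i]) 2))\<^sup>2 + (u (vtx (w @ [i]) 0) - u (vtx (w @ [i]) 2))\<^sup>2)"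
      using cell_energy_mono[of "u (vtx w 0)" "u (vtx w 1)" "u (vtx w 2)" "u (vtx (w @ [0]) 1)" "u (vtx (w @ [0]) 2)" "u (vtx (w @ [1]) 2)"]
      unfolding sum_UNIV_3 vtx_snoc_swap[of w 1 0] vtx_snoc_swap[of w 2 0] vtx_snoc_swap[of w 2 1] vtx_snoc_same .
  qed
  then show ?thesis by simp
qed

text \<open>Summation by parts, which holds in each cell separately. The sum includes the corners of
  \<open>SG\<close>, so no boundary term appears.\<close>

lemma energy_by_parts: "(\<Sum>x\<in>vertices q m. u x * vsum m u x) = - energy m u"
proof -
  have "(\<Sum>x\<in>vertices q m. u x * vsum m u x) =
    (\<Sum>x\<in>vertices q m. \<Sum>(w, i)\<in>inc m x. u (vtx w i) * (\<Sum>j\<in>UNIV. u (vtx w j) - u (vtx w i)))"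
    unfolding vsum_def sum_distrib_left[of _ _ "inc m _"] by (intro sum.cong refl) (auto simp: inc_def)
  also have "\<dots> = (\<Sum>w\<in>words m. \<Sum>i\<in>UNIV. u (vtx w i) * (\<Sum>j\<in>UNIV. u (vtx w j) - u (vtx w i)))"
    by (rule sum_vertices)
  also have "\<dots> = (\<Sum>w\<in>words m. - ((u (vtx w 0) - u (vtx w 1))\<^sup>2 + (u (vtx w 1) - u (vtx w 2))\<^sup>2 + (u (vtx w 0) - u (vtx w 2))\<^sup>2))"
    unfolding sum_UNIV_3 by (intro sum.cong refl) (simp add: power2_eq_square algebra_simps)
  finally show ?thesis unfolding energy_def sum_negf .
qed

text \<open>Gauss-Green formula without boundary term, since \<open>u\<close> vanishes at the
  corners. The rescaled energy is a Riemann sum of \<open>u * p\<close> up to the uniform error of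
  the graph Laplacian.\<close>

lemma energy_limit:
  assumes u: "has_laplacian q SG u (\<lambda>x. - p x)" and u0: "\<And>i. u (q i) = 0"
  shows "(\<lambda>m. (5/3) ^ m * energy m u) \<longlonglongrightarrow> (\<integral>x. u x * p x \<partial>\<mu>)"
proof -
  have cu: "continuous_on SG u" using u by (simp add: has_laplacian_def)
  have cp: "continuous_on SG p" using u continuous_on_minus[of SG "\<lambda>x. - p x"] by (simp add: has_laplacian_def)
  obtain C where C: "C \<ge> 0" "\<And>x. x \<in> SG \<Longrightarrow> \<bar>u x\<bar> \<le> C" using continuous_bounded[OF cu] by blast
  define R where "R m = (1/3) ^ Suc m * (\<Sum>w\<in>words m. \<Sum>i\<in>UNIV. u (vtx w i) * p (vtx w i))" for m
  have R: "R \<longlonglongrightarrow> (\<integral>x. u x * p x \<partial>\<mu>)"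
    unfolding R_def using riemann_sums[of "\<lambda>x. u x * p x"] cu cp by (simp add: continuous_on_mult)
  let ?I = "\<lambda>m. vertices q m - vertices q 0"
  have v0: "u x = 0" if "x \<in> vertices q 0" for x using that u0 by auto
  \<comment> \<open>Interior vertices are counted twice, which explains the 2; the boundary drops
    out through \<open>u\<close>.\<close>
  have R_eq: "R m = 2/3 * (1/3) ^ m * (\<Sum>x\<in>?I m. u x * p x)" for m
  proof -
    have "(\<Sum>w\<in>words m. \<Sum>i\<in>UNIV. u (vtx w i) * p (vtx w i)) = (\<Sum>x\<in>vertices q m. \<Sum>(w, i)\<in>inc m x. u (vtx w i) * p (vtx w i))"
      by (rule sum_vertices[symmetric])
    also have "\<dots> = (\<Sum>x\<in>vertices q m. \<Sum>(w, i)\<in>inc m x. u x * p x)"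
      by (intro sum.cong refl) (auto simp: inc_def)
    also have "\<dots> = (\<Sum>x\<in>?I m. real (card (inc m x)) * (u x * p x))"
      by (rule sum.mono_neutral_cong_right) (use v0 in \<open>auto simp del: vertices.simps\<close>)
    also have "\<dots> = (\<Sum>x\<in>?I m. 2 * (u x * p x))"
      by (intro sum.cong refl) (simp add: card_inc)
    finally show ?thesis unfolding R_def sum_distrib_left[symmetric] by simp
  qed
  have E_eq: "(5/3) ^ m * energy m u = - (2/3 * (1/3) ^ m * (\<Sum>x\<in>?I m. u x * graph_laplacian q SG m u x))" for m
  proof -
    have e: "energy m u = - (\<Sum>x\<in>?I m. u x * vsum m u x)"
    proof -
      have "(\<Sum>x\<in>vertices q m. u x * vsum m u x) = (\<Sum>x\<in>?I m. u x * vsum m u x)"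
        by (rule sum.mono_neutral_right) (use v0 in \<open>auto simp del: vertices.simps\<close>)
      then show ?thesis using energy_by_parts[where m = m and u = u] by simp
    qed
    have s: "(\<Sum>x\<in>?I m. u x * graph_laplacian q SG m u x) = 3/2 * 5 ^ m * (\<Sum>x\<in>?I m. u x * vsum m u x)"
      unfolding sum_distrib_left by (intro sum.cong refl) (simp add: graph_laplacian_eq del: vertices.simps)
    show ?thesis unfolding e s by (simp add: power_divide)
  qed
  have "(\<lambda>m. (5/3) ^ m * energy m u - R m) \<longlonglongrightarrow> 0"
  proof (rule LIMSEQ_I)
    fix r :: real assume "r > 0"
    \<comment> \<open>At most \<open>3 ^ Suc m\<close> vertices, each with error
      \<open>C * e\<close> and weight \<open>2/3 * (1/3) ^ m\<close>, give \<open>2 * C * e\<close>;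
      the added 1 makes this less than \<open>r\<close> even for C = 0.\<close>
    define e where "e = r / (2 * C + 1)"
    have e: "e > 0" "2 * C * e < r" using \<open>r > 0\<close> C(1) by (auto simp: e_def field_simps)
    then obtain M where M: "\<forall>m\<ge>M. \<forall>x \<in> ?I m. \<bar>graph_laplacian q SG m u x - - p x\<bar> < e"
      using u unfolding has_laplacian_def by blast
    have "norm ((5/3) ^ m * energy m u - R m - 0) < r" if m: "m \<ge> M" for m
    proof -
      have "(5/3) ^ m * energy m u - R m = - (2/3 * (1/3) ^ m * (\<Sum>x\<in>?I m. u x * (graph_laplacian q SG m u x - - p x)))"
        unfolding E_eq R_eq by (simp add: sum.distrib algebra_simps)
      then have "\<bar>(5/3) ^ m * energy m u - R m\<bar> = 2/3 * (1/3) ^ m * \<bar>\<Sum>x\<in>?I m. u x * (graph_laplacian q SG m u x - - p x)\<bar>"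
        by (simp add: abs_mult)
      also have "\<bar>\<Sum>x\<in>?I m. u x * (graph_laplacian q SG m u x - - p x)\<bar> \<le> (\<Sum>x\<in>?I m. C * e)"
      proof (rule order_trans[OF sum_abs], rule sum_mono)
        fix x assume x: "x \<in> ?I m"
        then have "x \<in> SG" using vertices_subset_SG by blast
        then show "\<bar>u x * (graph_laplacian q SG m u x - - p x)\<bar> \<le> C * e"
          unfolding abs_mult using M m x C by (intro mult_mono) (auto intro: less_imp_le simp del: vertices.simps)
      qed
      also have "(\<Sum>x\<in>?I m. C * e) \<le> 3 ^ Suc m * (C * e)"
      proof -
        have "card (?I m) \<le> card (vertices q m)" by (intro card_mono) auto
        also have "\<dots> \<le> card (words m \<times> (UNIV :: 3 set))"
          unfolding vertices_eq by (intro card_image_le) auto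
        also have "\<dots> = 3 ^ Suc m" by (simp add: card_cartesian_product card_words)
        finally have "real (card (?I m)) \<le> 3 ^ Suc m" by (metis of_nat_le_iff of_nat_numeral of_nat_power)
        then show ?thesis using C(1) e(1) by (simp add: mult_right_mono del: power_Suc)
      qed
      finally have "\<bar>(5/3) ^ m * energy m u - R m\<bar> \<le> 2/3 * (1/3) ^ m * (3 ^ Suc m * (C * e))" by simp
      also have "\<dots> = 2 * C * e" by (simp add: power_divide)
      finally show ?thesis using e(2) by simp
    qed
    then show "\<exists>no. \<forall>m\<ge>no. norm ((5/3) ^ m * energy m u - R m - 0) < r" by blast
  qed
  from tendsto_add[OF this R] show ?thesis by simp
qed

text \<open>The limit dominates every single energy, so one positive energy suffices. If all were
  zero, \<open>u\<close> would vanish on \<open>SG\<close> and its Laplacian would too, contrary to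
  the hypothesis on \<open>p\<close>.\<close>

lemma energy_pos:
  assumes u: "has_laplacian q SG u (\<lambda>x. - p x)" and u0: "\<And>i. u (q i) = 0" and p: "x \<in> SG" "p x \<noteq> 0"
  shows "(\<integral>x. u x * p x \<partial>\<mu>) > 0"
proof -
  have "incseq (\<lambda>m. (5/3) ^ m * energy m u)"
  proof (rule incseq_SucI)
    fix m show "(5/3) ^ m * energy m u \<le> (5/3) ^ Suc m * energy (Suc m) u"
      using mult_left_mono[OF energy_mono[of m u], of "(5/3) ^ m"] by (simp add: mult_ac)
  qed
  then have le: "(5/3) ^ m * energy m u \<le> (\<integral>x. u x * p x \<partial>\<mu>)" for m
    using incseq_le energy_limit[OF u u0] by blast
  have "\<exists>m. energy m u \<noteq> 0"
  proof (rule ccontr)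
    assume "\<not> (\<exists>m. energy m u \<noteq> 0)"
    then have z: "energy m u = 0" for m by blast
    have eq: "u (vtx w i) = u (vtx w j)" for w i j
    proof -
      have "(u (vtx w 0) - u (vtx w 1))\<^sup>2 + (u (vtx w 1) - u (vtx w 2))\<^sup>2 + (u (vtx w 0) - u (vtx w 2))\<^sup>2 = 0"
        using z[of "length w"] unfolding energy_def by (subst (asm) sum_nonneg_eq_0_iff) auto
      then have "u (vtx w 0) = u (vtx w 1)" "u (vtx w 0) = u (vtx w 2)"
        by (auto simp: add_nonneg_eq_0_iff)
      then have "\<forall>i. u (vtx w i) = u (vtx w 0)" unfolding forall_3_eq by simp
      then show ?thesis by metis
    qed
    \<comment> \<open>A subcell shares corner \<open>a\<close> with its parent, so the boundary
      value 0 spreads from level to level.\<close>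
    have "u (vtx w i) = 0" for w i
    proof (induction w arbitrary: i rule: rev_induct)
      case (snoc a w)
      then show ?case using eq[of "w @ [a]" i a] by simp
    qed (simp add: u0)
    then have "u x = 0" if "x \<in> vertices q m" for x m using that unfolding vertices_eq by auto
    then have "u x = 0" if "x \<in> SG" for x
      using vanish_on_SG[of u] u that unfolding has_laplacian_def by blast
    then have "has_laplacian q SG (\<lambda>x. 0) (\<lambda>x. - p x)" using has_laplacian_cong[OF u, of "\<lambda>x. 0"] by simp
    from has_laplacian_of_zero[OF this p(1)] show False using p(2) by simp
  qed
  then obtain m where "energy m u > 0" using energy_nonneg less_eq_real_def by metis
  then have "(5/3) ^ m * energy m u > 0" by simp
  then show ?thesis using le[of m] by simp
qed

end

section \<open>Orthogonal polynomials\<close>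

context gasket_green begin

section \<open>Inner product and Cauchy-Schwarz inequality\<close>

lemma l2_inner_commute: "l2_inner \<mu> f g = l2_inner \<mu> g f"
  by (simp add: l2_inner_def mult.commute)

lemma l2_inner_cong:
  assumes "\<And>x. x \<in> SG \<Longrightarrow> f x = f' x" "\<And>x. x \<in> SG \<Longrightarrow> g x = g' x"
  shows "l2_inner \<mu> f g = l2_inner \<mu> f' g'"
  unfolding l2_inner_def by (intro Bochner_Integration.integral_cong) (auto simp: space_mu assms)

lemma l2_integrable:
  assumes "continuous_on SG f" "continuous_on SG g"
  shows "integrable \<mu> (\<lambda>x. f x * g x :: real)"
  by (intro continuous_integrable continuous_on_mult assms)

lemma l2_inner_add:
  assumes "continuous_on SG f" "continuous_on SG g" "continuous_on SG h"
  shows "l2_inner \<mu> f (\<lambda>x. g x + h x) = l2_inner \<mu> f g + l2_inner \<mu> f h"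
  unfolding l2_inner_def using l2_integrable assms by (simp add: distrib_left)

lemma l2_inner_scale: "l2_inner \<mu> f (\<lambda>x. c * g x) = c * l2_inner \<mu> f g"
proof -
  have "l2_inner \<mu> f (\<lambda>x. c * g x) = (LINT x|\<mu>. c * (f x * g x))"
    unfolding l2_inner_def by (simp add: mult_ac)
  then show ?thesis by (simp add: l2_inner_def)
qed

lemma l2_inner_sum:
  fixes k :: nat
  assumes "continuous_on SG f" "\<And>l. l < k \<Longrightarrow> continuous_on SG (v l)"
  shows "l2_inner \<mu> f (\<lambda>x. \<Sum>l<k. c l * v l x) = (\<Sum>l<k. c l * l2_inner \<mu> f (v l))"
  using assms(2)
proof (induction k)
  case (Suc k)
  have "continuous_on SG (\<lambda>x. \<Sum>l<k. c l * v l x)" "continuous_on SG (\<lambda>x. c k * v k x)"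
    using Suc.prems by (intro continuous_intros; simp)+
  then show ?case using Suc l2_inner_add[OF assms(1)] by (simp add: l2_inner_scale)
qed (simp add: l2_inner_def)

lemma l2_inner_nonneg: "l2_inner \<mu> f f \<ge> 0"
  by (simp add: l2_inner_def)

lemma l2_norm_nonneg: "l2_norm \<mu> f \<ge> 0"
  by (simp add: l2_norm_def l2_inner_nonneg)

lemma l2_norm_square: "(l2_norm \<mu> f)\<^sup>2 = l2_inner \<mu> f f"
  by (simp add: l2_norm_def l2_inner_nonneg)

lemma l2_Cauchy_Schwarz:
  assumes f: "continuous_on SG f" and g: "continuous_on SG g"
  shows "(l2_inner \<mu> f g)\<^sup>2 \<le> l2_inner \<mu> f f * l2_inner \<mu> g g"
proof -
  let ?a = "l2_inner \<mu> f f" and ?b = "l2_inner \<mu> f g" and ?c = "l2_inner \<mu> g g"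
  have sq: "0 \<le> s\<^sup>2 * ?a + 2 * s * t * ?b + t\<^sup>2 * ?c" for s t
  proof -
    have "0 \<le> (LINT x|\<mu>. (s * f x + t * g x)\<^sup>2)" by simp
    also have "\<dots> = (LINT x|\<mu>. s\<^sup>2 * (f x * f x) + 2 * s * t * (f x * g x) + t\<^sup>2 * (g x * g x))"
      by (intro Bochner_Integration.integral_cong) (auto simp: power2_eq_square algebra_simps)
    also have "\<dots> = s\<^sup>2 * ?a + 2 * s * t * ?b + t\<^sup>2 * ?c"
      using l2_integrable[OF f f] l2_integrable[OF f g] l2_integrable[OF g g] by (simp add: l2_inner_def)
    finally show ?thesis .
  qed
  show ?thesis
  proof (cases "?c = 0")
    case True
    have "?b = 0"
    proof (rule ccontr)
      assume "?b \<noteq> 0"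
      \<comment> \<open>With \<open>?c\<close> zero the form is affine in t; this t gives the value
        \<open>?a - 2 * (?a + 1)\<close>, which is negative.\<close>
      then have "0 \<le> - ?a - 2" using sq[of 1 "- (?a + 1) / ?b"] True by simp
      then show False using l2_inner_nonneg[of f] by simp
    qed
    then show ?thesis using True by simp
  next
    case False
    then have c: "?c > 0" using l2_inner_nonneg[of g] by simp
    have "0 \<le> ?c * (?a * ?c - ?b\<^sup>2)" using sq[of ?c "- ?b"] by (simp add: power2_eq_square algebra_simps)
    then show ?thesis using c by (simp add: zero_le_mult_iff)
  qed
qed

lemma l2_inner_le:
  assumes "continuous_on SG f" "continuous_on SG g"
  shows "\<bar>l2_inner \<mu> f g\<bar> \<le> l2_norm \<mu> f * l2_norm \<mu> g"
proof -
  have "(l2_inner \<mu> f g)\<^sup>2 \<le> (l2_norm \<mu> f * l2_norm \<mu> g)\<^sup>2"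
    using l2_Cauchy_Schwarz[OF assms] by (simp add: l2_norm_square power_mult_distrib)
  then have "\<bar>l2_inner \<mu> f g\<bar> \<le> \<bar>l2_norm \<mu> f * l2_norm \<mu> g\<bar>" unfolding abs_le_square_iff .
  then show ?thesis by (simp add: abs_mult l2_norm_nonneg)
qed

section \<open>The Green operator\<close>

lemma G_continuous: "continuous_on (SG \<times> SG) (\<lambda>(x, y). G x y)"
  and G_sym: "x \<in> SG \<Longrightarrow> y \<in> SG \<Longrightarrow> G x y = G y x"
  using green by (auto simp: is_green_function_def)

lemma G_section_continuous:
  assumes "x \<in> SG" shows "continuous_on SG (\<lambda>y. G x y)" "continuous_on SG (\<lambda>y. G y x)"
proof -
  have "continuous_on SG (\<lambda>y. (x, y))" "continuous_on SG (\<lambda>y. (y, x))" by (intro continuous_intros)+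
  from this[THEN continuous_on_compose2[OF G_continuous]]
  show "continuous_on SG (\<lambda>y. G x y)" "continuous_on SG (\<lambda>y. G y x)" using assms by auto
qed

lemma G_bounded: obtains B where "\<And>x y. x \<in> SG \<Longrightarrow> y \<in> SG \<Longrightarrow> \<bar>G x y\<bar> \<le> B"
proof -
  have "compact ((\<lambda>(x, y). G x y) ` (SG \<times> SG))"
    by (intro compact_continuous_image G_continuous compact_Times compact_SG)
  then have "bounded ((\<lambda>(x, y). G x y) ` (SG \<times> SG))" by (rule compact_imp_bounded)
  then obtain B where "\<forall>z\<in>(\<lambda>(x, y). G x y) ` (SG \<times> SG). norm z \<le> B"
    unfolding bounded_iff by blast
  then show ?thesis using that[of B] by fastforce
qed

text \<open>Dominated convergence with a constant majorant. The continuity is what makes this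
  function of \<open>x\<close> integrable in \<open>green_op_norm\<close>.\<close>

lemma G_section_norm_continuous: "continuous_on SG (\<lambda>x. LINT y|\<mu>. (G x y)\<^sup>2)"
proof (unfold continuous_on_sequentially, intro ballI allI impI)
  fix a s assume a: "a \<in> SG" and s: "(\<forall>n. s n \<in> SG) \<and> s \<longlonglongrightarrow> a"
  obtain B where B: "\<And>x y. x \<in> SG \<Longrightarrow> y \<in> SG \<Longrightarrow> \<bar>G x y\<bar> \<le> B" using G_bounded by blast
  have m: "(\<lambda>y. (G x y)\<^sup>2) \<in> borel_measurable \<mu>" if "x \<in> SG" for x
    by (intro continuous_measurable continuous_on_power G_section_continuous that)
  have "(\<lambda>n. LINT y|\<mu>. (G (s n) y)\<^sup>2) \<longlonglongrightarrow> (LINT y|\<mu>. (G a y)\<^sup>2)"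
  proof (rule integral_dominated_convergence[where w = "\<lambda>_. B\<^sup>2"])
    show "AE y in \<mu>. (\<lambda>n. (G (s n) y)\<^sup>2) \<longlonglongrightarrow> (G a y)\<^sup>2"
    proof (rule AE_I2)
      fix y assume "y \<in> space \<mu>"
      then have y: "y \<in> SG" by (simp add: space_mu)
      have "(\<lambda>n. G (s n) y) \<longlonglongrightarrow> G a y"
        using G_section_continuous(2)[OF y] a s unfolding continuous_on_sequentially by (auto simp: o_def)
      then show "(\<lambda>n. (G (s n) y)\<^sup>2) \<longlonglongrightarrow> (G a y)\<^sup>2" by (rule tendsto_power)
    qed
    show "AE y in \<mu>. norm ((G (s n) y)\<^sup>2) \<le> B\<^sup>2" for n
    proof (rule AE_I2)
      fix y assume "y \<in> space \<mu>"
      then have "\<bar>G (s n) y\<bar> \<le> B" using B s by (simp add: space_mu)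
      then show "norm ((G (s n) y)\<^sup>2) \<le> B\<^sup>2" by (simp add: abs_le_square_iff[symmetric])
    qed
  qed (use m a s in auto)
  then show "((\<lambda>x. LINT y|\<mu>. (G x y)\<^sup>2) \<circ> s) \<longlonglongrightarrow> (LINT y|\<mu>. (G a y)\<^sup>2)" by (simp add: o_def)
qed

lemma l2_norm_kernel_nonneg: "l2_norm_kernel \<mu> G \<ge> 0"
  by (simp add: l2_norm_kernel_def)

text \<open>Symmetry of \<open>G\<close> and renaming the bound variables exchange the order of
  integration.\<close>

lemma l2_norm_kernel_square: "(l2_norm_kernel \<mu> G)\<^sup>2 = (LINT x|\<mu>. (LINT y|\<mu>. (G x y)\<^sup>2))"
proof -
  have "(LINT y|\<mu>. (LINT x|\<mu>. (G x y)\<^sup>2)) = (LINT x|\<mu>. (LINT y|\<mu>. (G x y)\<^sup>2))"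
    by (intro Bochner_Integration.integral_cong refl) (auto simp: space_mu G_sym)
  then show ?thesis by (simp add: l2_norm_kernel_def)
qed

text \<open>The inverse of minus the Dirichlet Laplacian, hence positive. In the theorem
  \<open>f (k + 1)\<close> is its negative at \<open>p k\<close>.\<close>

definition green_op :: "(real^2 \<Rightarrow> real) \<Rightarrow> real^2 \<Rightarrow> real" where
  "green_op p x = (LINT y|\<mu>. G x y * p y)"

lemma green_op:
  assumes "continuous_on SG p"
  shows "has_laplacian q SG (green_op p) (\<lambda>x. - p x)" "green_op p (q i) = 0"
proof -
  have "has_laplacian q SG (green_op p) (\<lambda>x. - p x) \<and> (\<forall>v\<in>vertices q 0. green_op p v = 0)"
    unfolding green_iff[OF assms] by (simp add: green_op_def)
  then show "has_laplacian q SG (green_op p) (\<lambda>x. - p x)" "green_op p (q i) = 0" by auto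
qed

text \<open>Cauchy-Schwarz in \<open>y\<close> for each fixed \<open>x\<close>, then integration
  over \<open>x\<close>: the Hilbert-Schmidt bound.\<close>

lemma green_op_norm:
  assumes p: "continuous_on SG p"
  shows "l2_norm \<mu> (green_op p) \<le> l2_norm_kernel \<mu> G * l2_norm \<mu> p"
proof -
  have c: "continuous_on SG (green_op p)" using green_op[OF p] by (simp add: has_laplacian_def)
  have "green_op p x * green_op p x \<le> (LINT y|\<mu>. (G x y)\<^sup>2) * l2_inner \<mu> p p" if "x \<in> SG" for x
    using l2_Cauchy_Schwarz[OF G_section_continuous(1)[OF that] p]
    by (simp add: l2_inner_def green_op_def power2_eq_square)
  then have "l2_inner \<mu> (green_op p) (green_op p) \<le> (LINT x|\<mu>. (LINT y|\<mu>. (G x y)\<^sup>2) * l2_inner \<mu> p p)"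
    unfolding l2_inner_def[of _ "green_op p"]
    by (intro integral_mono l2_integrable c continuous_integrable continuous_intros G_section_norm_continuous)
      (simp add: space_mu)
  also have "\<dots> = (l2_norm_kernel \<mu> G * l2_norm \<mu> p)\<^sup>2"
    by (simp add: power_mult_distrib l2_norm_kernel_square l2_norm_square)
  finally show ?thesis
    unfolding l2_norm_square[symmetric] by (rule power2_le_imp_le) (simp add: l2_norm_kernel_nonneg l2_norm_nonneg)
qed

lemma green_op_pos:
  assumes "continuous_on SG p" "x \<in> SG" "p x \<noteq> 0"
  shows "l2_inner \<mu> (green_op p) p > 0"
  unfolding l2_inner_def using energy_pos[OF green_op(1)[OF assms(1)] green_op(2)[OF assms(1)] assms(2,3)] .

text \<open>The norm bounds the pairing with \<open>green_op p\<close> by Cauchy-Schwarz, and that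
  pairing is strictly positive by the energy argument.\<close>

lemma l2_norm_pos:
  assumes "continuous_on SG p" "x \<in> SG" "p x \<noteq> 0"
  shows "l2_norm \<mu> p > 0"
proof -
  have "continuous_on SG (green_op p)" using green_op[OF assms(1)] by (simp add: has_laplacian_def)
  from l2_inner_le[OF this assms(1)] have "l2_norm \<mu> p \<noteq> 0" using green_op_pos[OF assms] by auto
  then show ?thesis using l2_norm_nonneg[of p] by simp
qed

end

section \<open>The Gram-Schmidt sequence\<close>

locale antisym_polynomials = gasket_green +
  fixes P p :: "nat \<Rightarrow> real^2 \<Rightarrow> real" and d :: "nat \<Rightarrow> real"
  assumes monomial: "\<And>j. is_antisym_monomial q SG j (P j)"
    and gram_schmidt: "\<And>j x. p j x = P j x - (\<Sum>l<j. (d l)\<^sup>2 * l2_inner \<mu> (P j) (p l) * p l x)"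
    and d_eq: "\<And>k. d k = inverse (l2_norm \<mu> (p k))"
begin

lemma P_continuous: "continuous_on SG (P j)"
  by (rule antisym_monomial_continuous[OF monomial])

lemma p_expansion: "\<exists>a. \<forall>x. p k x = P k x + (\<Sum>l<k. a l * P l x)"
proof (induction k rule: less_induct)
  case (less k)
  have "\<exists>a. \<forall>x. p l x = (\<Sum>i<k. a i * P i x)" if l: "l < k" for l
  proof -
    obtain a where a: "\<And>x. p l x = P l x + (\<Sum>i<l. a i * P i x)" using less[OF l] by blast
    \<comment> \<open>\<open>p l\<close> is monic; setting the coefficient at \<open>l\<close> to 1
      absorbs its leading term into the sum.\<close>
    let ?a = "a(l := 1)"
    have "(\<Sum>i<k. (if i \<le> l then ?a i else 0) * P i x) = (\<Sum>i<Suc l. ?a i * P i x)" for x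
      using l by (intro sum.mono_neutral_cong_right) auto
    also have "\<dots> x = p l x" for x by (simp add: a)
    finally show ?thesis by metis
  qed
  then obtain A where A: "\<And>l x. l < k \<Longrightarrow> p l x = (\<Sum>i<k. A l i * P i x)" by metis
  define \<alpha> where "\<alpha> l = - ((d l)\<^sup>2 * l2_inner \<mu> (P k) (p l))" for l
  have "p k x = P k x + (\<Sum>i<k. (\<Sum>l<k. \<alpha> l * A l i) * P i x)" for x
  proof -
    have "p k x = P k x + (\<Sum>l<k. \<alpha> l * p l x)"
      by (subst gram_schmidt) (simp add: \<alpha>_def sum_negf)
    also have "(\<Sum>l<k. \<alpha> l * p l x) = (\<Sum>l<k. \<Sum>i<k. \<alpha> l * A l i * P i x)"
      by (intro sum.cong refl) (simp add: A sum_distrib_left mult.assoc)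
    also have "\<dots> = (\<Sum>i<k. (\<Sum>l<k. \<alpha> l * A l i) * P i x)"
      by (subst sum.swap) (simp add: sum_distrib_right)
    finally show ?thesis .
  qed
  then show ?case by (intro exI[of _ "\<lambda>i. \<Sum>l<k. \<alpha> l * A l i"]) blast
qed

lemma p_continuous: "continuous_on SG (p k)"
proof -
  obtain a where "p k = (\<lambda>x. P k x + (\<Sum>l<k. a l * P l x))" using p_expansion by blast
  then show ?thesis by (simp add: P_continuous continuous_intros)
qed

lemma p_nonzero: "\<exists>x\<in>SG. p k x \<noteq> 0"
  using p_expansion[of k] antisym_monomials_independent[of P k, OF monomial] by metis

lemma norm_p_pos: "l2_norm \<mu> (p k) > 0"
  using p_nonzero[of k] l2_norm_pos[OF p_continuous] by blast

lemma d_square: "(d k)\<^sup>2 * l2_inner \<mu> (p k) (p k) = 1"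
  using norm_p_pos[of k] by (simp add: d_eq power_inverse flip: l2_norm_square)

lemma p_orthogonal: "l < k \<Longrightarrow> l2_inner \<mu> (p k) (p l) = 0"
proof (induction k arbitrary: l rule: less_induct)
  case (less k)
  define \<alpha> where "\<alpha> i = - ((d i)\<^sup>2 * l2_inner \<mu> (P k) (p i))" for i
  have pk: "p k = (\<lambda>x. P k x + (\<Sum>i<k. \<alpha> i * p i x))"
    by (rule ext, subst gram_schmidt) (simp add: \<alpha>_def sum_negf)
  have "l2_inner \<mu> (p l) (p k) = l2_inner \<mu> (p l) (P k) + (\<Sum>i<k. \<alpha> i * l2_inner \<mu> (p l) (p i))"
  proof -
    have "continuous_on SG (\<lambda>x. \<Sum>i<k. \<alpha> i * p i x)" by (intro continuous_intros p_continuous)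
    then show ?thesis unfolding pk
      by (simp add: l2_inner_add p_continuous P_continuous l2_inner_sum)
  qed
  also have "(\<Sum>i<k. \<alpha> i * l2_inner \<mu> (p l) (p i)) = (\<Sum>i<k. if i = l then \<alpha> l * l2_inner \<mu> (p l) (p l) else 0)"
  proof (intro sum.cong refl)
    fix i assume "i \<in> {..<k}"
    then have "l2_inner \<mu> (p l) (p i) = 0" if "i \<noteq> l"
      using less.IH[of l i] less.IH[of i l] less.prems that l2_inner_commute[of "p l" "p i"] by (cases "i < l") auto
    then show "\<alpha> i * l2_inner \<mu> (p l) (p i) = (if i = l then \<alpha> l * l2_inner \<mu> (p l) (p l) else 0)" by auto
  qed
  also have "\<dots> = \<alpha> l * l2_inner \<mu> (p l) (p l)" using less.prems by simp
  also have "\<dots> = - (((d l)\<^sup>2 * l2_inner \<mu> (p l) (p l)) * l2_inner \<mu> (P k) (p l))" by (simp add: \<alpha>_def)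
  also have "\<dots> = - l2_inner \<mu> (p l) (P k)" by (simp add: d_square l2_inner_commute)
  finally show ?case by (simp add: l2_inner_commute)
qed

text \<open>Read backwards, the Gram-Schmidt recursion writes \<open>P l\<close> as
  \<open>p l\<close> plus lower polynomials, all orthogonal to \<open>p k\<close> except possibly
  \<open>p l\<close> itself.\<close>

lemma p_inner_monomial:
  assumes "l \<le> k"
  shows "l2_inner \<mu> (p k) (P l) = (if l = k then l2_inner \<mu> (p k) (p k) else 0)"
proof -
  define \<alpha> where "\<alpha> i = (d i)\<^sup>2 * l2_inner \<mu> (P l) (p i)" for i
  have "P l = (\<lambda>x. p l x + (\<Sum>i<l. \<alpha> i * p i x))"
    using gram_schmidt[of l] by (auto simp: \<alpha>_def)
  moreover have "continuous_on SG (\<lambda>x. \<Sum>i<l. \<alpha> i * p i x)" by (intro continuous_intros p_continuous)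
  ultimately have "l2_inner \<mu> (p k) (P l) = l2_inner \<mu> (p k) (p l) + (\<Sum>i<l. \<alpha> i * l2_inner \<mu> (p k) (p i))"
    by (simp add: l2_inner_add p_continuous l2_inner_sum)
  also have "(\<Sum>i<l. \<alpha> i * l2_inner \<mu> (p k) (p i)) = 0"
    using assms by (intro sum.neutral) (auto simp: p_orthogonal)
  finally show ?thesis using assms p_orthogonal[of l k] by auto
qed

text \<open>\<open>green_antisym_span\<close> writes \<open>- green_op (p k)\<close> as
  \<open>P (Suc k)\<close> plus monomials of index at most k. Pairing with \<open>p (Suc k)\<close>
  leaves only the leading term.\<close>

lemma norm_p_Suc: "l2_inner \<mu> (p (Suc k)) (p (Suc k)) = - l2_inner \<mu> (p (Suc k)) (green_op (p k))"
proof -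
  obtain a where a: "p k = (\<lambda>x. P k x + (\<Sum>l<k. a l * P l x))" using p_expansion by blast
  have "has_laplacian q SG (\<lambda>x. - green_op (p k) x) (p k)"
    using has_laplacian_lincomb[OF green_op(1)[OF p_continuous[of k]] has_laplacian_zero, of "- 1" 0] by simp
  then obtain t where t: "\<And>x. x \<in> SG \<Longrightarrow> - green_op (p k) x = P (Suc k) x + (\<Sum>l<k. a l * P (Suc l) x) + t * P 0 x"
    using green_antisym_span[OF monomial, of "\<lambda>x. - green_op (p k) x" k a] green_op(2)[OF p_continuous[of k]]
    unfolding a by auto
  have c: "continuous_on SG (\<lambda>x. \<Sum>l<k. a l * P (Suc l) x)" "continuous_on SG (\<lambda>x. t * P 0 x)"
    by (intro continuous_intros P_continuous)+
  have "- l2_inner \<mu> (p (Suc k)) (green_op (p k)) = l2_inner \<mu> (p (Suc k)) (\<lambda>x. - green_op (p k) x)"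
    using l2_inner_scale[of "p (Suc k)" "- 1" "green_op (p k)"] by simp
  also have "\<dots> = l2_inner \<mu> (p (Suc k)) (\<lambda>x. P (Suc k) x + (\<Sum>l<k. a l * P (Suc l) x) + t * P 0 x)"
    by (intro l2_inner_cong t refl)
  also have "\<dots> = l2_inner \<mu> (p (Suc k)) (P (Suc k)) + (\<Sum>l<k. a l * l2_inner \<mu> (p (Suc k)) (P (Suc l))) + t * l2_inner \<mu> (p (Suc k)) (P 0)"
    using c by (simp add: l2_inner_add l2_inner_sum l2_inner_scale p_continuous P_continuous continuous_on_add)
  also have "\<dots> = l2_inner \<mu> (p (Suc k)) (p (Suc k))" by (simp add: p_inner_monomial)
  finally show ?thesis by simp
qed

lemma norm_p_Suc_le: "l2_norm \<mu> (p (Suc k)) \<le> l2_norm_kernel \<mu> G * l2_norm \<mu> (p k)"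
proof -
  have c: "continuous_on SG (green_op (p k))" using green_op[OF p_continuous] by (simp add: has_laplacian_def)
  have "(l2_norm \<mu> (p (Suc k)))\<^sup>2 \<le> l2_norm \<mu> (p (Suc k)) * l2_norm \<mu> (green_op (p k))"
    using l2_inner_le[OF p_continuous[of "Suc k"] c] norm_p_Suc[of k] by (simp add: l2_norm_square)
  then have "l2_norm \<mu> (p (Suc k)) \<le> l2_norm \<mu> (green_op (p k))"
    using norm_p_pos[of "Suc k"] by (simp add: power2_eq_square)
  then show ?thesis using green_op_norm[OF p_continuous[of k]] by simp
qed

end

theorem theorem3p4:
  fixes q :: "3 \<Rightarrow> real^2"
    and SG :: "(real^2) set"
    and \<mu> :: "(real^2) measure"
    and G :: "real^2 \<Rightarrow> real^2 \<Rightarrow> real"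
    and P p f :: "nat \<Rightarrow> real^2 \<Rightarrow> real"
    and d b c :: "nat \<Rightarrow> real"
  assumes "equilateral q"
    and "is_gasket q SG"
    and "is_gasket_measure q SG \<mu>"
    and "is_green_function q SG \<mu> G"
    and "\<And>j. is_antisym_monomial q SG j (P j)"
    and "p 0 = P 0"
    and "\<And>j x. j \<ge> 1 \<Longrightarrow> p j x = P j x - (\<Sum>l<j. (d l)\<^sup>2 * l2_inner \<mu> (P j) (p l) * p l x)"
    and "\<And>k. d k = inverse (l2_norm \<mu> (p k))"
    and "\<And>k x. f (k + 1) x = - (LINT y|\<mu>. G x y * p k y)"
    and "\<And>k. b k = (d k)\<^sup>2 * l2_inner \<mu> (f (k + 1)) (p k)"
    and "\<And>k. k \<ge> 1 \<Longrightarrow> c k = (d (k - 1))\<^sup>2 / (d k)\<^sup>2"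
  shows "(\<forall>k. - l2_norm_kernel \<mu> G \<le> b k \<and> b k < 0) \<and>
         (\<forall>k\<ge>1. 0 < c k \<and> c k \<le> (l2_norm_kernel \<mu> G)\<^sup>2) \<and>
         (\<forall>k. inverse (d (k + 1)) \<le> l2_norm_kernel \<mu> G * inverse (d k)) \<and>
         (\<forall>k. inverse (d k) \<le> inverse (d 0) * l2_norm_kernel \<mu> G ^ k)"
proof -
  \<comment> \<open>For j = 0 the sum is empty, so one recursion covers both hypotheses.\<close>
  have gs: "p j x = P j x - (\<Sum>l<j. (d l)\<^sup>2 * l2_inner \<mu> (P j) (p l) * p l x)" for j x
    using assms(6) assms(7)[of j x] by (cases j) auto
  interpret antisym_polynomials q SG \<mu> G P p d
    by unfold_locales (fact assms gs)+
  define N where "N k = l2_norm \<mu> (p k)" for k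
  let ?K = "l2_norm_kernel \<mu> G"
  have N: "N k > 0" "N (Suc k) \<le> ?K * N k" "inverse (d k) = N k" for k
    using norm_p_pos norm_p_Suc_le assms(8) by (simp_all add: N_def)
  have K: "?K \<ge> 0" by (rule l2_norm_kernel_nonneg)
  have "- ?K \<le> b k \<and> b k < 0" for k
  proof -
    have "f (k + 1) = (\<lambda>x. (- 1) * green_op (p k) x)" using assms(9) by (auto simp: green_op_def)
    \<comment> \<open>Minus the Rayleigh quotient of the Green operator at
      \<open>p k\<close>.\<close>
    then have bk: "b k = - (l2_inner \<mu> (green_op (p k)) (p k) / (N k)\<^sup>2)"
      using l2_inner_scale[of "p k" "- 1" "green_op (p k)"] assms(8,10)
      by (simp add: l2_inner_commute N_def power_inverse field_simps)
    have "l2_inner \<mu> (green_op (p k)) (p k) > 0"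
      using green_op_pos[OF p_continuous] p_nonzero by blast
    moreover have "l2_inner \<mu> (green_op (p k)) (p k) \<le> ?K * (N k)\<^sup>2"
    proof -
      have "l2_inner \<mu> (green_op (p k)) (p k) \<le> l2_norm \<mu> (green_op (p k)) * N k"
        using l2_inner_le[of "green_op (p k)" "p k"] green_op(1)[OF p_continuous[of k]] p_continuous
        by (simp add: has_laplacian_def N_def)
      also have "\<dots> \<le> ?K * N k * N k"
        using green_op_norm[OF p_continuous[of k]] N(1)[of k] by (intro mult_right_mono) (auto simp: N_def)
      finally show ?thesis by (simp add: power2_eq_square)
    qed
    ultimately have "l2_inner \<mu> (green_op (p k)) (p k) / (N k)\<^sup>2 > 0"
      "l2_inner \<mu> (green_op (p k)) (p k) / (N k)\<^sup>2 \<le> ?K" using N(1)[of k] by (simp_all add: divide_le_eq)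
    then show ?thesis unfolding bk by simp
  qed
  moreover have "0 < c k \<and> c k \<le> ?K\<^sup>2" if k: "k \<ge> 1" for k
  proof -
    obtain j where j: "k = Suc j" using k by (cases k) auto
    \<comment> \<open>A squared ratio of consecutive norms, so (b) is the square of (c).\<close>
    have ck: "c k = (N k / N j)\<^sup>2"
      using assms(11)[OF k] assms(8) j by (simp add: N_def power_inverse power_divide field_simps)
    have r: "0 < N k / N j" "N k / N j \<le> ?K" using N(1)[of k] N(1)[of j] N(2)[of j] j by (simp_all add: field_simps)
    show ?thesis unfolding ck using zero_less_power[OF r(1)] power_mono[OF r(2) less_imp_le[OF r(1)]] by blast
  qed
  moreover have "N k \<le> N 0 * ?K ^ k" for k
  proof (induction k)
    case (Suc k)
    have "N (Suc k) \<le> ?K * N k" by (rule N(2))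
    also have "\<dots> \<le> ?K * (N 0 * ?K ^ k)" using Suc K by (rule mult_left_mono)
    finally show ?case by (simp add: mult_ac)
  qed simp
  ultimately show ?thesis using N(2,3) by simp
qed

end
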